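(* Let $X$ be a continuous semimartingale with local time $L_t^x(X)$. Then for every $x\in\mathbb{R}$ and $t\ge 0$, almost surely, $$|X_t-x|=|X_0-x|+\int_0^t\mathrm{sgn}(X_s-x)\,dX_s+L_t^x(X),$$ $$(X_t-x)^+=(X_0-x)^++\int_0^t I\{X_s>x\}\,dX_s+\tfrac12 L_t^x(X),$$ $$(X_t-x)^-=(X_0-x)^--\int_0^t I\{X_s\le x\}\,dX_s+\tfrac12 L_t^x(X).$$
   Context: A continuous semimartingale is a process $X=M+A$ on a filtered probability space, with $M$ a continuous local martingale and $A$ a continuous adapted process of locally bounded variation with $A_0=0$. The sign function is $\mathrm{sgn}(x)=-1$ for $x\le 0$ and $\mathrm{sgn}(x)=1$ for $x>0$. $I\{\cdot\}$ denotes an indicator; $y^+=\max(y,0)$, $y^-=\max(-y,0)$. For each $x\in\mathbb{R}$, the local time of $X$ at $x$ is the process defined by $$L_t^x(X)=|X_t-x|-|X_0-x|-\int_0^t\mathrm{sgn}(X_s-x)\,dX_s .$$ *)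

theory Defs
  imports "HOL-Probability.Probability"
begin

section \<open>Filtered probability spaces and processes\<close>

text \<open>
  Time is \<open>[0,\<infinity>)\<close>. Processes and filtrations are indexed by \<^typ>\<open>real\<close>, and nothing below
  looks at a process at negative times. A filtration on \<open>[0,\<infinity>)\<close> is turned into one on all of
  \<^typ>\<open>real\<close> by \<open>F t = F 0\<close> for \<open>t < 0\<close>. No completeness or right-continuity is assumed.
\<close>

locale filtered_prob_space = prob_space P + filtration "space P" F
  for P :: "'a measure" and F :: "real \<Rightarrow> 'a measure" +
  assumes sets_F_subset: "\<And>t. sets (F t) \<subseteq> sets P"

definition completed_filtration :: "'a measure \<Rightarrow> (real \<Rightarrow> 'a measure) \<Rightarrow> real \<Rightarrow> 'a measure" where
  "completed_filtration P F t = sigma (space P) (sets (F t) \<union> null_sets P)"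

definition adapted :: "(real \<Rightarrow> 'a measure) \<Rightarrow> (real \<Rightarrow> 'a \<Rightarrow> real) \<Rightarrow> bool" where
  "adapted F X \<longleftrightarrow> (\<forall>t\<ge>0. X t \<in> borel_measurable (F t))"

definition cont_paths :: "'a measure \<Rightarrow> (real \<Rightarrow> 'a \<Rightarrow> real) \<Rightarrow> bool" where
  "cont_paths P X \<longleftrightarrow> (\<forall>\<omega>\<in>space P. continuous_on {0..} (\<lambda>t. X t \<omega>))"

definition progressive :: "(real \<Rightarrow> 'a measure) \<Rightarrow> (real \<Rightarrow> 'a \<Rightarrow> real) \<Rightarrow> bool" where
  "progressive F V \<longleftrightarrow>
     (\<forall>t\<ge>0. (\<lambda>(s, \<omega>). V s \<omega>) \<in> borel_measurable (restrict_space borel {0..t} \<Otimes>\<^sub>M F t))"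

definition martingale :: "'a measure \<Rightarrow> (real \<Rightarrow> 'a measure) \<Rightarrow> (real \<Rightarrow> 'a \<Rightarrow> real) \<Rightarrow> bool" where
  "martingale P F M \<longleftrightarrow> adapted F M \<and> (\<forall>t\<ge>0. integrable P (M t)) \<and>
     (\<forall>s\<ge>0. \<forall>t\<ge>s. AE \<omega> in P. real_cond_exp P (F s) (M t) \<omega> = M s \<omega>)"

text \<open>
  The localizing stopping times are finite valued because the codomain of a library stopping time
  is the time type. This is no restriction: a localizing sequence \<open>\<tau>\<^sub>n\<close> with values in \<open>[0,\<infinity>]\<close> may be
  replaced by \<open>min \<tau>\<^sub>n n\<close>.
\<close>

definition cont_local_martingale ::
  "'a measure \<Rightarrow> (real \<Rightarrow> 'a measure) \<Rightarrow> (real \<Rightarrow> 'a \<Rightarrow> real) \<Rightarrow> bool" where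
  "cont_local_martingale P F M \<longleftrightarrow> adapted F M \<and> cont_paths P M \<and>
     (\<exists>\<tau> :: nat \<Rightarrow> 'a \<Rightarrow> real.
        (\<forall>n. stopping_time F (\<tau> n) \<and> (\<forall>\<omega>\<in>space P. 0 \<le> \<tau> n \<omega>)) \<and>
        (AE \<omega> in P. incseq (\<lambda>n. \<tau> n \<omega>) \<and> filterlim (\<lambda>n. \<tau> n \<omega>) at_top sequentially) \<and>
        (\<forall>n. martingale P F (\<lambda>t \<omega>. M (min t (\<tau> n \<omega>)) \<omega> - M 0 \<omega>)))"


section \<open>Paths of locally bounded variation\<close>

definition variation_sums :: "(real \<Rightarrow> real) \<Rightarrow> real \<Rightarrow> real set" where
  "variation_sums a t =
     {\<Sum>i<n. \<bar>a (s (Suc i)) - a (s i)\<bar> | n s. incseq s \<and> 0 \<le> s 0 \<and> s n \<le> t}"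

definition locally_bv :: "(real \<Rightarrow> real) \<Rightarrow> bool" where
  "locally_bv a \<longleftrightarrow> (\<forall>t\<ge>0. bdd_above (variation_sums a t))"

text \<open>The argument is clipped at 0 so that the result is a nondecreasing function on the whole line.\<close>

definition variation :: "(real \<Rightarrow> real) \<Rightarrow> real \<Rightarrow> real" where
  "variation a t = Sup (variation_sums a (max 0 t))"

text \<open>
  Lebesgue--Stieltjes integral of \<open>f\<close> over \<open>(0,t]\<close> against a continuous path \<open>a\<close> of locally
  bounded variation, through \<open>a = v - (v - a)\<close> with \<open>v\<close> the total variation of \<open>a\<close>.
\<close>

definition stieltjes_integrable :: "(real \<Rightarrow> real) \<Rightarrow> (real \<Rightarrow> real) \<Rightarrow> bool" where
  "stieltjes_integrable f a \<longleftrightarrow>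
     (\<forall>t\<ge>0. set_integrable (interval_measure (variation a)) {0<..t} f)"

definition stieltjes_integral :: "(real \<Rightarrow> real) \<Rightarrow> (real \<Rightarrow> real) \<Rightarrow> real \<Rightarrow> real" where
  "stieltjes_integral f a t =
     (LINT s:{0<..t}|interval_measure (variation a). f s) -
     (LINT s:{0<..t}|interval_measure (\<lambda>s. variation a s - a (max 0 s)). f s)"

definition cont_bv_process ::
  "'a measure \<Rightarrow> (real \<Rightarrow> 'a measure) \<Rightarrow> (real \<Rightarrow> 'a \<Rightarrow> real) \<Rightarrow> bool" where
  "cont_bv_process P F A \<longleftrightarrow> adapted F A \<and> cont_paths P A \<and>
     (\<forall>\<omega>\<in>space P. A 0 \<omega> = 0 \<and> locally_bv (\<lambda>t. A t \<omega>))"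


section \<open>Continuous semimartingales\<close>

definition semimartingale_decomp ::
  "'a measure \<Rightarrow> (real \<Rightarrow> 'a measure) \<Rightarrow> (real \<Rightarrow> 'a \<Rightarrow> real) \<Rightarrow>
   (real \<Rightarrow> 'a \<Rightarrow> real) \<Rightarrow> (real \<Rightarrow> 'a \<Rightarrow> real) \<Rightarrow> bool" where
  "semimartingale_decomp P F X M A \<longleftrightarrow>
     cont_local_martingale P F M \<and> cont_bv_process P F A \<and>
     (\<forall>t\<ge>0. \<forall>\<omega>\<in>space P. X t \<omega> = M t \<omega> + A t \<omega>)"

definition cont_semimartingale ::
  "'a measure \<Rightarrow> (real \<Rightarrow> 'a measure) \<Rightarrow> (real \<Rightarrow> 'a \<Rightarrow> real) \<Rightarrow> bool" where
  "cont_semimartingale P F X \<longleftrightarrow> (\<exists>M A. semimartingale_decomp P F X M A)"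


section \<open>Stochastic integrals\<close>

text \<open>
  \<open>C\<close> is a version of the covariation \<open>[M,N]\<close> of two continuous local martingales: the continuous
  adapted process of locally bounded variation, null at 0, for which \<open>M N - C\<close> is a local martingale.
\<close>

definition has_covariation ::
  "'a measure \<Rightarrow> (real \<Rightarrow> 'a measure) \<Rightarrow> (real \<Rightarrow> 'a \<Rightarrow> real) \<Rightarrow> (real \<Rightarrow> 'a \<Rightarrow> real) \<Rightarrow>
   (real \<Rightarrow> 'a \<Rightarrow> real) \<Rightarrow> bool" where
  "has_covariation P F M N C \<longleftrightarrow>
     cont_bv_process P F C \<and> cont_local_martingale P F (\<lambda>t \<omega>. M t \<omega> * N t \<omega> - C t \<omega>)"

text \<open>
  \<open>Z\<close> is a version of \<open>\<integral> V dM\<close> for a continuous local martingale \<open>M\<close>: \<open>V\<close> is progressive with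
  \<open>\<integral> V\<^sup>2 d[M] < \<infinity>\<close>, and \<open>Z\<close> is the continuous local martingale null at 0 with
  \<open>[Z,N] = \<integral> V d[M,N]\<close> for every continuous local martingale \<open>N\<close>.
\<close>

definition has_local_martingale_integral ::
  "'a measure \<Rightarrow> (real \<Rightarrow> 'a measure) \<Rightarrow> (real \<Rightarrow> 'a \<Rightarrow> real) \<Rightarrow> (real \<Rightarrow> 'a \<Rightarrow> real) \<Rightarrow>
   (real \<Rightarrow> 'a \<Rightarrow> real) \<Rightarrow> bool" where
  "has_local_martingale_integral P F V M Z \<longleftrightarrow>
     progressive F V \<and>
     (\<exists>Q. has_covariation P F M M Q \<and>
        (AE \<omega> in P. stieltjes_integrable (\<lambda>s. (V s \<omega>)\<^sup>2) (\<lambda>s. Q s \<omega>))) \<and>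
     cont_local_martingale P F Z \<and> (\<forall>\<omega>\<in>space P. Z 0 \<omega> = 0) \<and>
     (\<forall>N. cont_local_martingale P F N \<longrightarrow>
        (\<exists>C D. has_covariation P F M N C \<and> has_covariation P F Z N D \<and>
           (AE \<omega> in P. \<forall>t\<ge>0.
              D t \<omega> = stieltjes_integral (\<lambda>s. V s \<omega>) (\<lambda>s. C s \<omega>) t)))"

text \<open>
  \<open>Y\<close> is a version of \<open>\<integral> V dX = \<integral> V dM + \<integral> V dA\<close> for a semimartingale \<open>X = M + A\<close>. The construction
  is carried out in the completed filtration, since without the null sets a version of the
  integral that is both continuous and adapted need not exist. Versions are
  unique up to indistinguishability.
\<close>

definition has_stoch_integral ::
  "'a measure \<Rightarrow> (real \<Rightarrow> 'a measure) \<Rightarrow> (real \<Rightarrow> 'a \<Rightarrow> real) \<Rightarrow> (real \<Rightarrow> 'a \<Rightarrow> real) \<Rightarrow>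
   (real \<Rightarrow> 'a \<Rightarrow> real) \<Rightarrow> bool" where
  "has_stoch_integral P F V X Y \<longleftrightarrow>
     (let G = completed_filtration P F in
      \<exists>M A Z. semimartingale_decomp P G X M A \<and>
        has_local_martingale_integral P G V M Z \<and>
        (AE \<omega> in P. stieltjes_integrable (\<lambda>s. V s \<omega>) (\<lambda>s. A s \<omega>)) \<and>
        (AE \<omega> in P. \<forall>t\<ge>0.
           Y t \<omega> = Z t \<omega> + stieltjes_integral (\<lambda>s. V s \<omega>) (\<lambda>s. A s \<omega>) t))"

definition stoch_integrable ::
  "'a measure \<Rightarrow> (real \<Rightarrow> 'a measure) \<Rightarrow> (real \<Rightarrow> 'a \<Rightarrow> real) \<Rightarrow> (real \<Rightarrow> 'a \<Rightarrow> real) \<Rightarrow> bool" where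
  "stoch_integrable P F V X \<longleftrightarrow> (\<exists>Y. has_stoch_integral P F V X Y)"

definition stoch_integral ::
  "'a measure \<Rightarrow> (real \<Rightarrow> 'a measure) \<Rightarrow> (real \<Rightarrow> 'a \<Rightarrow> real) \<Rightarrow> (real \<Rightarrow> 'a \<Rightarrow> real) \<Rightarrow>
   real \<Rightarrow> 'a \<Rightarrow> real" where
  "stoch_integral P F V X = (SOME Y. has_stoch_integral P F V X Y)"


section \<open>Local time\<close>

text \<open>The left-continuous sign, unlike \<^const>\<open>sgn\<close> which vanishes at 0.\<close>

definition lsgn :: "real \<Rightarrow> real" where
  "lsgn x = (if x \<le> 0 then -1 else 1)"

text \<open>
  \<open>L\<close> is (a version of) the local time of \<open>X\<close> at \<open>x\<close>. The first conjunct says that the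
  integral defining the local time is an actual stochastic integral and not the arbitrary value
  of the choice operator. For a continuous semimartingale \<open>X\<close> it holds by the general existence
  theorem, the integrand being bounded and progressive.
\<close>

definition is_local_time ::
  "'a measure \<Rightarrow> (real \<Rightarrow> 'a measure) \<Rightarrow> (real \<Rightarrow> 'a \<Rightarrow> real) \<Rightarrow> real \<Rightarrow>
   (real \<Rightarrow> 'a \<Rightarrow> real) \<Rightarrow> bool" where
  "is_local_time P F X x L \<longleftrightarrow>
     stoch_integrable P F (\<lambda>s \<omega>. lsgn (X s \<omega> - x)) X \<and>
     (AE \<omega> in P. \<forall>t\<ge>0.
        L t \<omega> = \<bar>X t \<omega> - x\<bar> - \<bar>X 0 \<omega> - x\<bar>
          - stoch_integral P F (\<lambda>s \<omega>. lsgn (X s \<omega> - x)) X t \<omega>)"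

end

theory Submission
  imports Defs
begin

text \<open>
  Since the indicators of \<open>X > x\<close> and \<open>X \<le> x\<close> are \<open>(1 \<plusminus> sgn (X - x)) / 2\<close>, the last two formulas
  are half the sum and half the difference of the first one and \<open>X\<^sub>t - X\<^sub>0 = \<integral> 1 dX\<close>. As
  \<^const>\<open>stoch_integral\<close> picks an arbitrary version, this needs that the integral is affine in a bounded
  integrand and unique up to null sets. Both rest on two facts: continuous local martingales form a
  vector space (by optional stopping), and those with paths of locally bounded variation are
  constant. The latter makes the decomposition \<open>X = M + A\<close> and the covariations unique; for two versions \<open>Z\<close>, \<open>Z'\<close> of
  \<open>\<integral> V dM\<close>, testing against \<open>N = Z - Z'\<close> shows that \<open>(Z - Z')\<^sup>2\<close> is a local martingale null at 0.
\<close>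

section \<open>Optional stopping for continuous martingales\<close>

context filtered_prob_space
begin

text \<open>Existence of integrals enters only through \<open>is_local_time\<close>: it provides one
  version of the integral of \<open>lsgn (X - x)\<close>, and from it a version for every affine
  image of the integrand can be written down. Boundedness of the integrand gives all the pathwise
  integrability. The constant integrand contributes \<open>M t - M 0\<close>, centred because
  integrals start at 0; this is where the possibly unbounded \<open>M 0\<close> has to be absorbed
  into a localizing sequence. Optional stopping is what closes local martingales under sums: two of
  them come with different localizing sequences, so each must survive being stopped by the sequence
  of the other. It is reached from finitely valued times by uniform integrability, in the concrete
  form of a bound on the excess over a level \<open>c\<close>, because such a bound follows from
  convexity and is uniform over the sampling times. Two versions of an integral may rest on
  decompositions that agree only almost surely. Almost sure equality does not preserve adaptedness
  in an arbitrary filtration, so the lemmas on null processes carry adaptedness along.\<close>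

lemma measurable_F_mono:
  "s \<le> t \<Longrightarrow> f \<in> borel_measurable (F s) \<Longrightarrow> f \<in> borel_measurable (F t)"
  using measurable_mono[of borel borel "F s" "F t"] sets_F_mono[of s t] by (auto simp: space_F)

lemma measurable_F_P: "f \<in> borel_measurable (F t) \<Longrightarrow> f \<in> borel_measurable P"
  using measurable_mono[of borel borel "F t" P] sets_F_subset[of t] by (auto simp: space_F)

lemma sigma_finite_subalgebra_F: "sigma_finite_subalgebra P (F s)"
proof -
  interpret finite_measure_subalgebra P "F s"
    by unfold_locales (use sets_F_subset in \<open>auto simp: subalgebra_def space_F\<close>)
  show ?thesis by unfold_locales
qed

section \<open>Martingales tested against bounded weights\<close>

lemma integrable_bounded_mult:
  fixes f g :: "'a \<Rightarrow> real"
  assumes "integrable P g" "f \<in> borel_measurable P" "\<And>\<omega>. \<omega> \<in> space P \<Longrightarrow> \<bar>f \<omega>\<bar> \<le> K"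
  shows "integrable P (\<lambda>\<omega>. f \<omega> * g \<omega>)"
proof (rule Bochner_Integration.integrable_bound)
  show "integrable P (\<lambda>\<omega>. K * g \<omega>)" using assms by auto
  show "(\<lambda>\<omega>. f \<omega> * g \<omega>) \<in> borel_measurable P" using assms by auto
  show "AE \<omega> in P. norm (f \<omega> * g \<omega>) \<le> norm (K * g \<omega>)"
  proof (intro AE_I2)
    fix \<omega> assume "\<omega> \<in> space P"
    then have "\<bar>f \<omega>\<bar> \<le> \<bar>K\<bar>" using assms(3) by fastforce
    then show "norm (f \<omega> * g \<omega>) \<le> norm (K * g \<omega>)" by (simp add: abs_mult mult_right_mono)
  qed
qed

text \<open>Arbitrary bounded weights known at time \<open>s\<close> are allowed, not just
  indicators: signs, partial sums and initial values all occur as weights later.\<close>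

lemma martingale_integral_eq:
  assumes "martingale P F M" "0 \<le> s" "s \<le> t"
    and \<xi>: "\<xi> \<in> borel_measurable (F s)" "\<And>\<omega>. \<omega> \<in> space P \<Longrightarrow> \<bar>\<xi> \<omega>\<bar> \<le> K"
  shows "(\<integral>\<omega>. \<xi> \<omega> * M t \<omega> \<partial>P) = (\<integral>\<omega>. \<xi> \<omega> * M s \<omega> \<partial>P)"
proof -
  interpret S: sigma_finite_subalgebra P "F s" by (rule sigma_finite_subalgebra_F)
  have int: "integrable P (M t)" "integrable P (M s)"
    and ae: "AE \<omega> in P. real_cond_exp P (F s) (M t) \<omega> = M s \<omega>"
    using assms by (auto simp: martingale_def)
  have "(\<integral>\<omega>. \<xi> \<omega> * real_cond_exp P (F s) (M t) \<omega> \<partial>P) = (\<integral>\<omega>. \<xi> \<omega> * M t \<omega> \<partial>P)"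
    by (rule S.real_cond_exp_intg(2))
      (use int \<xi> in \<open>auto intro!: integrable_bounded_mult measurable_F_P\<close>)
  moreover have "(\<integral>\<omega>. \<xi> \<omega> * real_cond_exp P (F s) (M t) \<omega> \<partial>P) = (\<integral>\<omega>. \<xi> \<omega> * M s \<omega> \<partial>P)"
    using ae int measurable_F_P[OF \<xi>(1)] by (intro integral_cong_AE) auto
  ultimately show ?thesis by simp
qed

text \<open>The converse, with indicators as the only weights. Together the two directions let
  martingales be handled through plain integrals instead of conditional expectations.\<close>

lemma martingaleI:
  assumes "adapted F M" "\<And>t. 0 \<le> t \<Longrightarrow> integrable P (M t)"
    and "\<And>s t A. 0 \<le> s \<Longrightarrow> s \<le> t \<Longrightarrow> A \<in> sets (F s) \<Longrightarrow>
      (\<integral>\<omega>. indicator A \<omega> * M t \<omega> \<partial>P) = (\<integral>\<omega>. indicator A \<omega> * M s \<omega> \<partial>P)"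
  shows "martingale P F M"
  unfolding martingale_def
proof (intro conjI allI impI)
  fix s t :: real assume st: "0 \<le> s" "s \<le> t"
  interpret S: sigma_finite_subalgebra P "F s" by (rule sigma_finite_subalgebra_F)
  show "AE \<omega> in P. real_cond_exp P (F s) (M t) \<omega> = M s \<omega>"
  proof (rule S.real_cond_exp_charact)
    show "integrable P (M t)" "integrable P (M s)" using assms(2) st by auto
    show "M s \<in> borel_measurable (F s)" using assms(1) st by (auto simp: adapted_def)
    show "(LINT \<omega>:A|P. M t \<omega>) = (LINT \<omega>:A|P. M s \<omega>)" if "A \<in> sets (F s)" for A
      using assms(3)[OF st that] by (simp add: set_lebesgue_integral_def)
  qed
qed (use assms in auto)

lemma martingaleD:
  assumes "martingale P F M" "0 \<le> t"
  shows "integrable P (M t)" "M t \<in> borel_measurable (F t)"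
  using assms by (auto simp: martingale_def adapted_def)

text \<open>Jensen's inequality for the convex function \<open>max 0 (\<bar>v\<bar> - c)\<close>,
  obtained from a supporting line at \<open>M s\<close>. Summed over the values of a sampling time
  it bounds the sampled excess by that of the final value.\<close>

lemma martingale_excess_mono:
  assumes M: "martingale P F M" and st: "0 \<le> s" "s \<le> t" and B: "B \<in> sets (F s)" and c: "0 \<le> c"
  shows "(\<integral>\<omega>. indicator B \<omega> * max 0 (\<bar>M s \<omega>\<bar> - c) \<partial>P)
    \<le> (\<integral>\<omega>. indicator B \<omega> * max 0 (\<bar>M t \<omega>\<bar> - c) \<partial>P)"
proof -
  have meas: "M s \<in> borel_measurable (F s)" and int: "integrable P (M s)" "integrable P (M t)"
    using martingaleD[OF M] st by auto
  note [measurable] = meas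
  \<comment> \<open>A subgradient at \<open>M s\<close>: on \<open>B\<close> the line
    \<open>\<xi> * v - c * \<bar>\<xi>\<bar>\<close> lies below the convex function for every
    \<open>v\<close> and touches it at \<open>v = M s\<close>.\<close>
  define \<xi> where "\<xi> \<omega> = indicator B \<omega> * (if M s \<omega> > c then 1 else if M s \<omega> < - c then - 1 else 0 :: real)" for \<omega>
  have \<xi>F: "\<xi> \<in> borel_measurable (F s)" unfolding \<xi>_def using B by measurable
  have \<xi>B: "\<bar>\<xi> \<omega>\<bar> \<le> 1" for \<omega> by (auto simp: \<xi>_def indicator_def)
  have \<xi>P: "\<xi> \<in> borel_measurable P" using \<xi>F by (rule measurable_F_P)
  have BP: "B \<in> sets P" using B sets_F_subset by auto
  have int\<xi>: "integrable P (\<lambda>\<omega>. \<xi> \<omega> * M s \<omega>)" "integrable P (\<lambda>\<omega>. \<xi> \<omega> * M t \<omega>)"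
    "integrable P (\<lambda>\<omega>. c * \<bar>\<xi> \<omega>\<bar>)"
    using integrable_bounded_mult[OF int(1) \<xi>P, of 1] integrable_bounded_mult[OF int(2) \<xi>P, of 1]
      \<xi>P \<xi>B by (auto intro!: integrable_const_bound[of _ 1] integrable_mult_right)
  have "(\<integral>\<omega>. indicator B \<omega> * max 0 (\<bar>M s \<omega>\<bar> - c) \<partial>P) = (\<integral>\<omega>. \<xi> \<omega> * M s \<omega> - c * \<bar>\<xi> \<omega>\<bar> \<partial>P)"
    using c by (intro Bochner_Integration.integral_cong) (auto simp: \<xi>_def indicator_def)
  also have "\<dots> = (\<integral>\<omega>. \<xi> \<omega> * M t \<omega> - c * \<bar>\<xi> \<omega>\<bar> \<partial>P)"
    using int\<xi> martingale_integral_eq[OF M st \<xi>F \<xi>B] by simp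
  also have "\<dots> \<le> (\<integral>\<omega>. indicator B \<omega> * max 0 (\<bar>M t \<omega>\<bar> - c) \<partial>P)"
  proof (rule integral_mono)
    show "integrable P (\<lambda>\<omega>. indicator B \<omega> * max 0 (\<bar>M t \<omega>\<bar> - c))"
      using int BP by (intro integrable_bounded_mult[where K=1]) auto
  qed (use int\<xi> c in \<open>auto simp: \<xi>_def indicator_def\<close>)
  finally show ?thesis .
qed

section \<open>Sampling at finitely valued times\<close>

text \<open>On each event \<open>T = u\<close> the value \<open>M u\<close> is compared with
  \<open>M t\<close>, and the finitely many pieces are added. The right-hand side of the third
  conclusion does not involve \<open>T\<close>, which makes sampled families uniformly integrable;
  the hypothesis of the fourth says that \<open>A\<close> belongs to the past of
  \<open>T\<close>.\<close>

lemma simple_sampling: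
  assumes M: "martingale P F M" and U: "finite U" "U \<subseteq> {0..t}"
    and T: "\<And>\<omega>. \<omega> \<in> space P \<Longrightarrow> T \<omega> \<in> U"
    and TF: "\<And>u. u \<in> U \<Longrightarrow> {\<omega>\<in>space P. T \<omega> = u} \<in> sets (F u)"
  shows "integrable P (\<lambda>\<omega>. M (T \<omega>) \<omega>)"
    and "(\<lambda>\<omega>. M (T \<omega>) \<omega>) \<in> borel_measurable (F t)"
    and "0 \<le> c \<Longrightarrow> (\<integral>\<omega>. max 0 (\<bar>M (T \<omega>) \<omega>\<bar> - c) \<partial>P) \<le> (\<integral>\<omega>. max 0 (\<bar>M t \<omega>\<bar> - c) \<partial>P)"
    and "(\<And>u. u \<in> U \<Longrightarrow> A \<inter> {\<omega>\<in>space P. T \<omega> = u} \<in> sets (F u)) \<Longrightarrow>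
      (\<integral>\<omega>. indicator A \<omega> * M (T \<omega>) \<omega> \<partial>P) = (\<integral>\<omega>. indicator A \<omega> * M t \<omega> \<partial>P)"
proof -
  define B where "B u = {\<omega>\<in>space P. T \<omega> = u}" for u
  have BF: "B u \<in> sets (F u)" "B u \<in> sets P" if "u \<in> U" for u
    using TF that sets_F_subset by (auto simp: B_def)
  have split: "f (T \<omega>) = (\<Sum>u\<in>U. indicator (B u) \<omega> * f u)" if "\<omega> \<in> space P" for \<omega> and f :: "real \<Rightarrow> real"
  proof -
    have "(\<Sum>u\<in>U. indicator (B u) \<omega> * f u) = (\<Sum>u\<in>U. if u = T \<omega> then f u else 0)"
      using that by (intro sum.cong) (auto simp: B_def)
    then show ?thesis using T[OF that] U by simp
  qed
  have U0: "0 \<le> u" "u \<le> t" if "u \<in> U" for u using U that by auto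
  obtain \<omega>0 where "\<omega>0 \<in> space P" using not_empty by auto
  then have t0: "0 \<le> t" using U0[OF T, of \<omega>0] by linarith
  have int: "integrable P (M u)" if "u \<in> U" for u using martingaleD[OF M U0(1)[OF that]] by simp
  have intt: "integrable P (M t)" using martingaleD[OF M t0] by simp
  have intB: "integrable P (\<lambda>\<omega>. indicator (B u) \<omega> * f \<omega>)" if "u \<in> U" "integrable P f" for u and f :: "'a \<Rightarrow> real"
    using that BF by (intro integrable_bounded_mult[where K=1]) auto
  show "integrable P (\<lambda>\<omega>. M (T \<omega>) \<omega>)"
    by (subst Bochner_Integration.integrable_cong[OF refl split]) (use int intB in auto)
  show "(\<lambda>\<omega>. M (T \<omega>) \<omega>) \<in> borel_measurable (F t)"
  proof (subst measurable_cong)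
    show "M (T \<omega>) \<omega> = (\<Sum>u\<in>U. indicator (B u) \<omega> * M u \<omega>)" if "\<omega> \<in> space (F t)" for \<omega>
      using split[of \<omega> "\<lambda>u. M u \<omega>"] that by (simp add: space_F)
    show "(\<lambda>\<omega>. \<Sum>u\<in>U. indicator (B u) \<omega> * M u \<omega>) \<in> borel_measurable (F t)"
    proof (intro borel_measurable_sum borel_measurable_times)
      fix u assume u: "u \<in> U"
      show "M u \<in> borel_measurable (F t)"
        using martingaleD[OF M U0(1)[OF u]] measurable_F_mono U0(2)[OF u] by blast
      show "(indicator (B u) :: 'a \<Rightarrow> real) \<in> borel_measurable (F t)"
        using BF[OF u] sets_F_mono[OF U0(2)[OF u]] by auto
    qed
  qed
  have "(\<integral>\<omega>. max 0 (\<bar>M (T \<omega>) \<omega>\<bar> - c) \<partial>P) \<le> (\<integral>\<omega>. max 0 (\<bar>M t \<omega>\<bar> - c) \<partial>P)" if c: "0 \<le> c"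
  proof -
    have "(\<integral>\<omega>. max 0 (\<bar>M (T \<omega>) \<omega>\<bar> - c) \<partial>P)
        = (\<integral>\<omega>. (\<Sum>u\<in>U. indicator (B u) \<omega> * max 0 (\<bar>M u \<omega>\<bar> - c)) \<partial>P)"
      by (intro Bochner_Integration.integral_cong refl split)
    also have "\<dots> = (\<Sum>u\<in>U. \<integral>\<omega>. indicator (B u) \<omega> * max 0 (\<bar>M u \<omega>\<bar> - c) \<partial>P)"
      by (intro Bochner_Integration.integral_sum intB) (use int in auto)
    also have "\<dots> \<le> (\<Sum>u\<in>U. \<integral>\<omega>. indicator (B u) \<omega> * max 0 (\<bar>M t \<omega>\<bar> - c) \<partial>P)"
      by (intro sum_mono martingale_excess_mono M U0 BF c)
    also have "\<dots> = (\<integral>\<omega>. (\<Sum>u\<in>U. indicator (B u) \<omega> * max 0 (\<bar>M t \<omega>\<bar> - c)) \<partial>P)"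
      by (intro Bochner_Integration.integral_sum[symmetric] intB) (use intt in auto)
    also have "\<dots> = (\<integral>\<omega>. max 0 (\<bar>M t \<omega>\<bar> - c) \<partial>P)"
      by (intro Bochner_Integration.integral_cong refl split[symmetric, of _ "\<lambda>_. max 0 (\<bar>M t _\<bar> - c)"])
    finally show ?thesis .
  qed
  then show "0 \<le> c \<Longrightarrow> (\<integral>\<omega>. max 0 (\<bar>M (T \<omega>) \<omega>\<bar> - c) \<partial>P) \<le> (\<integral>\<omega>. max 0 (\<bar>M t \<omega>\<bar> - c) \<partial>P)" .
  assume "\<And>u. u \<in> U \<Longrightarrow> A \<inter> {\<omega>\<in>space P. T \<omega> = u} \<in> sets (F u)"
  then have AF: "A \<inter> B u \<in> sets (F u)" "A \<inter> B u \<in> sets P" if "u \<in> U" for u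
    using that sets_F_subset by (auto simp: B_def)
  have intA: "integrable P (\<lambda>\<omega>. indicator (A \<inter> B u) \<omega> * f \<omega>)" if "u \<in> U" "integrable P f" for u and f :: "'a \<Rightarrow> real"
    using that AF by (intro integrable_bounded_mult[where K=1]) auto
  have splitA: "indicator A \<omega> * f (T \<omega>) = (\<Sum>u\<in>U. indicator (A \<inter> B u) \<omega> * f u)" if "\<omega> \<in> space P" for \<omega> and f :: "real \<Rightarrow> real"
    unfolding split[OF that] sum_distrib_left by (intro sum.cong) (auto simp: indicator_def)
  have "(\<integral>\<omega>. indicator A \<omega> * M (T \<omega>) \<omega> \<partial>P) = (\<integral>\<omega>. (\<Sum>u\<in>U. indicator (A \<inter> B u) \<omega> * M u \<omega>) \<partial>P)"
    by (intro Bochner_Integration.integral_cong refl splitA)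
  also have "\<dots> = (\<Sum>u\<in>U. \<integral>\<omega>. indicator (A \<inter> B u) \<omega> * M u \<omega> \<partial>P)"
    by (intro Bochner_Integration.integral_sum intA) (use int in auto)
  also have "\<dots> = (\<Sum>u\<in>U. \<integral>\<omega>. indicator (A \<inter> B u) \<omega> * M t \<omega> \<partial>P)"
    by (intro sum.cong refl martingale_integral_eq[OF M, symmetric, where K=1] U0) (use AF in auto)
  also have "\<dots> = (\<integral>\<omega>. (\<Sum>u\<in>U. indicator (A \<inter> B u) \<omega> * M t \<omega>) \<partial>P)"
    by (intro Bochner_Integration.integral_sum[symmetric] intA) (use intt in auto)
  also have "\<dots> = (\<integral>\<omega>. indicator A \<omega> * M t \<omega> \<partial>P)"
    by (intro Bochner_Integration.integral_cong refl splitA[symmetric, of _ "\<lambda>_. M t _"])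
  finally show "(\<integral>\<omega>. indicator A \<omega> * M (T \<omega>) \<omega> \<partial>P) = (\<integral>\<omega>. indicator A \<omega> * M t \<omega> \<partial>P)" .
qed

end

text \<open>The common bound on the excesses \<open>(\<bar>Y k\<bar> - c)\<^sup>+\<close> is a form of uniform integrability: it tends to 0 as
  \<open>c \<rightarrow> \<infinity>\<close>, so \<open>Y k\<close> may be replaced by its truncation at level \<open>c\<close>, where dominated convergence applies.\<close>

lemma (in prob_space) uniformly_integrable_limit:
  fixes Y :: "nat \<Rightarrow> 'a \<Rightarrow> real"
  assumes int: "\<And>k. integrable M (Y k)" and intZ: "integrable M Z"
    and lim: "\<And>\<omega>. \<omega> \<in> space M \<Longrightarrow> (\<lambda>k. Y k \<omega>) \<longlonglongrightarrow> y \<omega>"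
    and bd: "\<And>k c. 0 \<le> c \<Longrightarrow> (\<integral>\<omega>. max 0 (\<bar>Y k \<omega>\<bar> - c) \<partial>M) \<le> (\<integral>\<omega>. max 0 (\<bar>Z \<omega>\<bar> - c) \<partial>M)"
  shows "integrable M y"
    and "A \<in> events \<Longrightarrow> (\<And>k. (\<integral>\<omega>. indicator A \<omega> * Y k \<omega> \<partial>M) = r) \<Longrightarrow> (\<integral>\<omega>. indicator A \<omega> * y \<omega> \<partial>M) = r"
proof -
  have [measurable]: "Y k \<in> borel_measurable M" "Z \<in> borel_measurable M" for k using int intZ by auto
  have ym[measurable]: "y \<in> borel_measurable M" by (rule borel_measurable_LIMSEQ_real[OF lim]) auto
  \<comment> \<open>Fatou's lemma; the hypothesis at level \<open>c = 0\<close> bounds the first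
    absolute moments.\<close>
  have "(\<integral>\<^sup>+\<omega>. ennreal \<bar>y \<omega>\<bar> \<partial>M) = (\<integral>\<^sup>+\<omega>. liminf (\<lambda>k. ennreal \<bar>Y k \<omega>\<bar>) \<partial>M)"
  proof (intro nn_integral_cong)
    fix \<omega> assume "\<omega> \<in> space M"
    then have "(\<lambda>k. ennreal \<bar>Y k \<omega>\<bar>) \<longlonglongrightarrow> ennreal \<bar>y \<omega>\<bar>"
      using lim by (intro tendsto_ennrealI tendsto_rabs) auto
    from lim_imp_Liminf[OF sequentially_bot this]
    show "ennreal \<bar>y \<omega>\<bar> = liminf (\<lambda>k. ennreal \<bar>Y k \<omega>\<bar>)" ..
  qed
  also have "\<dots> \<le> liminf (\<lambda>k. \<integral>\<^sup>+\<omega>. ennreal \<bar>Y k \<omega>\<bar> \<partial>M)" by (rule nn_integral_liminf) auto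
  also have "\<dots> \<le> ennreal (\<integral>\<omega>. \<bar>Z \<omega>\<bar> \<partial>M)"
  proof -
    have "(\<integral>\<^sup>+\<omega>. ennreal \<bar>Y k \<omega>\<bar> \<partial>M) \<le> ennreal (\<integral>\<omega>. \<bar>Z \<omega>\<bar> \<partial>M)" for k
      using bd[of 0 k] int[of k] by (subst nn_integral_eq_integral) (auto simp: ennreal_leI)
    then show ?thesis by (intro Liminf_le) auto
  qed
  also have "\<dots> < \<infinity>" by simp
  finally show inty: "integrable M y" by (intro integrableI_bounded) auto
  assume A[measurable]: "A \<in> events" and r: "\<And>k. (\<integral>\<omega>. indicator A \<omega> * Y k \<omega> \<partial>M) = r"
  define clip where "clip c v = max (- c) (min c v)" for c v :: real
  have clip_meas[measurable]: "clip c \<in> borel_measurable borel" for c unfolding clip_def by measurable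
  have *: "\<bar>(\<integral>\<omega>. indicator A \<omega> * clip c (y \<omega>) \<partial>M) - r\<bar> \<le> (\<integral>\<omega>. max 0 (\<bar>Z \<omega>\<bar> - c) \<partial>M)" if c: "c \<ge> 0" for c
  proof (rule tendsto_upperbound)
    show "(\<lambda>k. \<bar>(\<integral>\<omega>. indicator A \<omega> * clip c (Y k \<omega>) \<partial>M) - r\<bar>) \<longlonglongrightarrow> \<bar>(\<integral>\<omega>. indicator A \<omega> * clip c (y \<omega>) \<partial>M) - r\<bar>"
    proof (intro tendsto_rabs tendsto_diff tendsto_const integral_dominated_convergence[where w="\<lambda>_. c"] AE_I2)
      show "(\<lambda>k. indicator A \<omega> * clip c (Y k \<omega>)) \<longlonglongrightarrow> indicator A \<omega> * clip c (y \<omega>)" if "\<omega> \<in> space M" for \<omega>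
        unfolding clip_def using that by (intro tendsto_intros lim)
    qed (use c in \<open>auto simp: clip_def indicator_def\<close>)
    show "\<forall>\<^sub>F k in sequentially. \<bar>(\<integral>\<omega>. indicator A \<omega> * clip c (Y k \<omega>) \<partial>M) - r\<bar> \<le> (\<integral>\<omega>. max 0 (\<bar>Z \<omega>\<bar> - c) \<partial>M)"
    proof (intro always_eventually allI)
      fix k
      have i1: "integrable M (\<lambda>\<omega>. indicator A \<omega> * clip c (Y k \<omega>))"
        using c by (intro integrable_const_bound[where B=c]) (auto simp: clip_def indicator_def)
      have i2: "integrable M (\<lambda>\<omega>. indicator A \<omega> * Y k \<omega>)"
        using integrable_mult_indicator[OF A int[of k]] by simp
      have "\<bar>(\<integral>\<omega>. indicator A \<omega> * clip c (Y k \<omega>) \<partial>M) - r\<bar>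
          = \<bar>\<integral>\<omega>. indicator A \<omega> * clip c (Y k \<omega>) - indicator A \<omega> * Y k \<omega> \<partial>M\<bar>"
        using i1 i2 r[of k] by simp
      also have "\<dots> \<le> (\<integral>\<omega>. \<bar>indicator A \<omega> * clip c (Y k \<omega>) - indicator A \<omega> * Y k \<omega>\<bar> \<partial>M)"
        by (rule integral_abs_bound)
      \<comment> \<open>Clipping at level \<open>c\<close> moves a number \<open>v\<close> by
        exactly \<open>max 0 (\<bar>v\<bar> - c)\<close>.\<close>
      also have "\<dots> \<le> (\<integral>\<omega>. max 0 (\<bar>Y k \<omega>\<bar> - c) \<partial>M)"
        using i1 i2 int[of k] c by (intro integral_mono) (auto simp: clip_def indicator_def)
      also note bd[OF c, of k]
      finally show "\<bar>(\<integral>\<omega>. indicator A \<omega> * clip c (Y k \<omega>) \<partial>M) - r\<bar> \<le> (\<integral>\<omega>. max 0 (\<bar>Z \<omega>\<bar> - c) \<partial>M)" .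
    qed
  qed simp
  have "(\<lambda>n. \<bar>(\<integral>\<omega>. indicator A \<omega> * clip (real n) (y \<omega>) \<partial>M) - r\<bar>) \<longlonglongrightarrow> \<bar>(\<integral>\<omega>. indicator A \<omega> * y \<omega> \<partial>M) - r\<bar>"
  proof (intro tendsto_rabs tendsto_diff tendsto_const integral_dominated_convergence[where w="\<lambda>\<omega>. \<bar>y \<omega>\<bar>"] AE_I2)
    fix \<omega>
    have "\<forall>\<^sub>F n in sequentially. indicator A \<omega> * clip (real n) (y \<omega>) = indicator A \<omega> * y \<omega>"
    proof (rule eventually_sequentiallyI[of "nat \<lceil>\<bar>y \<omega>\<bar>\<rceil>"])
      fix n assume "nat \<lceil>\<bar>y \<omega>\<bar>\<rceil> \<le> n"
      then have "\<bar>y \<omega>\<bar> \<le> real n" by linarith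
      then show "indicator A \<omega> * clip (real n) (y \<omega>) = indicator A \<omega> * y \<omega>" by (auto simp: clip_def)
    qed
    then show "(\<lambda>n. indicator A \<omega> * clip (real n) (y \<omega>)) \<longlonglongrightarrow> indicator A \<omega> * y \<omega>"
      by (rule tendsto_eventually)
  qed (use inty in \<open>auto simp: clip_def indicator_def\<close>)
  moreover have "(\<lambda>n. \<integral>\<omega>. max 0 (\<bar>Z \<omega>\<bar> - real n) \<partial>M) \<longlonglongrightarrow> (\<integral>\<omega>. 0 \<partial>M)"
  proof (intro integral_dominated_convergence[where w="\<lambda>\<omega>. \<bar>Z \<omega>\<bar>"] AE_I2)
    fix \<omega>
    have "\<forall>\<^sub>F n in sequentially. max 0 (\<bar>Z \<omega>\<bar> - real n) = 0"
    proof (rule eventually_sequentiallyI[of "nat \<lceil>\<bar>Z \<omega>\<bar>\<rceil>"])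
      fix n assume "nat \<lceil>\<bar>Z \<omega>\<bar>\<rceil> \<le> n"
      then have "\<bar>Z \<omega>\<bar> \<le> real n" by linarith
      then show "max 0 (\<bar>Z \<omega>\<bar> - real n) = 0" by auto
    qed
    then show "(\<lambda>n. max 0 (\<bar>Z \<omega>\<bar> - real n)) \<longlonglongrightarrow> 0" by (rule tendsto_eventually)
  qed (use intZ in auto)
  ultimately have "\<bar>(\<integral>\<omega>. indicator A \<omega> * y \<omega> \<partial>M) - r\<bar> \<le> (\<integral>\<omega>. 0 \<partial>M)"
    by (rule LIMSEQ_le) (use * in auto)
  then show "(\<integral>\<omega>. indicator A \<omega> * y \<omega> \<partial>M) = r" by simp
qed

section \<open>Sampling a continuous martingale at a bounded stopping time\<close>

text \<open>Rounding up, not down, is what keeps the result a stopping time. The cap keeps it within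
  the horizon \<open>t\<close>, where \<open>M t\<close> serves as the closing value.\<close>

definition grid_time :: "real \<Rightarrow> ('a \<Rightarrow> real) \<Rightarrow> nat \<Rightarrow> 'a \<Rightarrow> real" where
  "grid_time t S k \<omega> = min t (of_int \<lceil>real (Suc k) * S \<omega>\<rceil> / real (Suc k))"

context filtered_prob_space
begin

lemma sampling_approx:
  assumes S: "stopping_time F S" "\<forall>\<omega>\<in>space P. 0 \<le> s \<and> s \<le> S \<omega> \<and> S \<omega> \<le> t"
  defines "T \<equiv> grid_time t S"
  shows "finite (T k ` space P)" "T k ` space P \<subseteq> {s..t}" "stopping_time F (T k)"
    "\<And>u. {\<omega>\<in>space P. T k \<omega> = u} \<in> sets (F u)"
    "\<And>\<omega>. \<omega> \<in> space P \<Longrightarrow> (\<lambda>k. T k \<omega>) \<longlonglongrightarrow> S \<omega>"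
proof -
  have lower: "S \<omega> \<le> T k \<omega>" if "\<omega> \<in> space P" for k \<omega>
    using bspec[OF S(2) that] by (auto simp: T_def grid_time_def field_simps simp del: of_nat_Suc)
  have "T k ` space P \<subseteq> (\<lambda>i::int. min t (of_int i / real (Suc k))) ` {0..\<lceil>real (Suc k) * t\<rceil>}"
  proof
    fix v assume "v \<in> T k ` space P"
    then obtain \<omega> where \<omega>: "\<omega> \<in> space P" "v = T k \<omega>" by auto
    have "real (Suc k) * S \<omega> \<le> real (Suc k) * t" "0 \<le> real (Suc k) * S \<omega>"
      using bspec[OF S(2) \<omega>(1)] by (auto intro!: mult_left_mono mult_nonneg_nonneg simp del: of_nat_Suc)
    then have "\<lceil>real (Suc k) * S \<omega>\<rceil> \<in> {0..\<lceil>real (Suc k) * t\<rceil>}"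
      by (auto intro!: ceiling_mono simp del: of_nat_Suc)
    then show "v \<in> (\<lambda>i::int. min t (of_int i / real (Suc k))) ` {0..\<lceil>real (Suc k) * t\<rceil>}"
      using \<omega>(2) unfolding T_def grid_time_def by blast
  qed
  then show "finite (T k ` space P)" by (rule finite_subset) auto
  show "T k ` space P \<subseteq> {s..t}"
  proof (intro image_subsetI)
    fix \<omega> assume "\<omega> \<in> space P"
    then show "T k \<omega> \<in> {s..t}"
      using lower[of \<omega> k] S(2) by (auto simp: T_def grid_time_def simp del: of_nat_Suc)
  qed
  show st: "stopping_time F (T k)"
  proof (rule stopping_timeI)
    fix u
    show "Measurable.pred (F u) (\<lambda>\<omega>. T k \<omega> \<le> u)"
    proof (cases "t \<le> u")
      case True
      then show ?thesis by (auto simp: T_def grid_time_def min_le_iff_disj)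
    next
      case False
      \<comment> \<open>A time rounded up is at most \<open>u\<close> exactly if \<open>S\<close> is
        at most the last grid point not after \<open>u\<close>; so the event is already decided at
        that grid point.\<close>
      have "T k \<omega> \<le> u \<longleftrightarrow> S \<omega> \<le> of_int \<lfloor>real (Suc k) * u\<rfloor> / real (Suc k)" for \<omega>
      proof -
        have "T k \<omega> \<le> u \<longleftrightarrow> of_int \<lceil>real (Suc k) * S \<omega>\<rceil> \<le> real (Suc k) * u"
          using False by (auto simp: T_def grid_time_def min_le_iff_disj field_simps simp del: of_nat_Suc)
        also have "\<dots> \<longleftrightarrow> \<lceil>real (Suc k) * S \<omega>\<rceil> \<le> \<lfloor>real (Suc k) * u\<rfloor>" by (simp add: le_floor_iff)
        also have "\<dots> \<longleftrightarrow> real (Suc k) * S \<omega> \<le> of_int \<lfloor>real (Suc k) * u\<rfloor>" by (simp add: ceiling_le_iff)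
        finally show ?thesis by (simp add: field_simps del: of_nat_Suc)
      qed
      moreover have "of_int \<lfloor>real (Suc k) * u\<rfloor> / real (Suc k) \<le> u"
        using of_int_floor_le[of "real (Suc k) * u"] by (simp add: field_simps del: of_nat_Suc)
      ultimately show ?thesis using stopping_time_le_const[OF S(1)] by simp
    qed
  qed
  show "{\<omega>\<in>space P. T k \<omega> = u} \<in> sets (F u)" for u
  proof -
    have [measurable]: "T k \<in> borel_measurable (pre_sigma (T k))"
      by (rule measurable_stopping_time_pre_sigma[OF st])
    \<comment> \<open>A stopping time is measurable with respect to its own past, and intersecting
      with \<open>T k \<le> u\<close> changes nothing on the event \<open>T k = u\<close>.\<close>
    have "{\<omega>\<in>space (pre_sigma (T k)). T k \<omega> = u} \<in> sets (pre_sigma (T k))" by measurable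
    from sets_pre_sigmaD[OF st this, of u] show ?thesis
      by (auto simp: space_pre_sigma elim!: rev_iffD1[OF _ arg_cong[where f="\<lambda>A. A \<in> sets (F u)"]])
  qed
  show "(\<lambda>k. T k \<omega>) \<longlonglongrightarrow> S \<omega>" if \<omega>: "\<omega> \<in> space P" for \<omega>
  proof (rule tendsto_sandwich[OF always_eventually always_eventually])
    show "\<forall>k. S \<omega> \<le> T k \<omega>" using lower[OF \<omega>] by auto
    show "\<forall>k. T k \<omega> \<le> S \<omega> + 1 / real (Suc k)"
    proof
      fix k
      have "of_int \<lceil>real (Suc k) * S \<omega>\<rceil> \<le> real (Suc k) * S \<omega> + 1" by linarith
      then have "of_int \<lceil>real (Suc k) * S \<omega>\<rceil> / real (Suc k) \<le> S \<omega> + 1 / real (Suc k)"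
        by (simp add: field_simps del: of_nat_Suc)
      then show "T k \<omega> \<le> S \<omega> + 1 / real (Suc k)" by (auto simp: T_def grid_time_def)
    qed
    show "(\<lambda>k. S \<omega> + 1 / real (Suc k)) \<longlonglongrightarrow> S \<omega>"
      using tendsto_add[OF tendsto_const LIMSEQ_inverse_real_of_nat, of "S \<omega>"] by (simp add: inverse_eq_divide)
  qed simp
qed

text \<open>Continuity of paths makes the values sampled on the grids converge, and the excess bound
  with closing value \<open>M t\<close> makes them uniformly integrable. The lower bound
  \<open>s\<close> passes to the grid times, so that every event of \<open>F s\<close> lies in the
  past of each of them.\<close>

lemma cont_sampling:
  assumes M: "martingale P F M" and cont: "cont_paths P M"
    and S: "stopping_time F S" "\<And>\<omega>. \<omega> \<in> space P \<Longrightarrow> s \<le> S \<omega> \<and> S \<omega> \<le> t" and s: "0 \<le> s"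
  shows "integrable P (\<lambda>\<omega>. M (S \<omega>) \<omega>)"
    and "(\<lambda>\<omega>. M (S \<omega>) \<omega>) \<in> borel_measurable (F t)"
    and "A \<in> sets (F s) \<Longrightarrow> (\<integral>\<omega>. indicator A \<omega> * M (S \<omega>) \<omega> \<partial>P) = (\<integral>\<omega>. indicator A \<omega> * M t \<omega> \<partial>P)"
proof -
  have S': "\<forall>\<omega>\<in>space P. 0 \<le> s \<and> s \<le> S \<omega> \<and> S \<omega> \<le> t" using S(2) s by auto
  define T where "T = grid_time t S"
  note ap = sampling_approx[OF S(1) S', folded T_def]
  have U: "finite (T k ` space P)" "T k ` space P \<subseteq> {0..t}" for k using ap(1,2)[of k] s by auto
  note sm = simple_sampling[OF M U(1) U(2) imageI ap(4)]
  have lim: "(\<lambda>k. M (T k \<omega>) \<omega>) \<longlonglongrightarrow> M (S \<omega>) \<omega>" if \<omega>: "\<omega> \<in> space P" for \<omega>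
  proof (rule continuous_on_tendsto_compose[OF _ ap(5)[OF \<omega>]])
    show "continuous_on {0..} (\<lambda>t. M t \<omega>)" using cont \<omega> by (auto simp: cont_paths_def)
    show "S \<omega> \<in> {0..}" using bspec[OF S' \<omega>] by auto
    show "\<forall>\<^sub>F k in sequentially. T k \<omega> \<in> {0..}" using U(2) \<omega> by (intro always_eventually) fastforce
  qed
  show "(\<lambda>\<omega>. M (S \<omega>) \<omega>) \<in> borel_measurable (F t)"
    by (rule borel_measurable_LIMSEQ_real[where u="\<lambda>k \<omega>. M (T k \<omega>) \<omega>"])
      (use lim sm(2) in \<open>auto simp: space_F\<close>)
  obtain \<omega>0 where "\<omega>0 \<in> space P" using not_empty by auto
  then have t0: "0 \<le> t" using S' by force
  note ui = uniformly_integrable_limit[where Y="\<lambda>k \<omega>. M (T k \<omega>) \<omega>" and y="\<lambda>\<omega>. M (S \<omega>) \<omega>" and Z="M t"]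
  show "integrable P (\<lambda>\<omega>. M (S \<omega>) \<omega>)"
    by (rule ui(1)) (use sm(1,3) martingaleD(1)[OF M t0] lim in auto)
  assume A: "A \<in> sets (F s)"
  have "A \<in> events" using A sets_F_subset by auto
  show "(\<integral>\<omega>. indicator A \<omega> * M (S \<omega>) \<omega> \<partial>P) = (\<integral>\<omega>. indicator A \<omega> * M t \<omega> \<partial>P)"
  proof (rule ui(2)[OF sm(1) martingaleD(1)[OF M t0] lim sm(3) \<open>A \<in> events\<close>])
    fix k
    show "(\<integral>\<omega>. indicator A \<omega> * M (T k \<omega>) \<omega> \<partial>P) = (\<integral>\<omega>. indicator A \<omega> * M t \<omega> \<partial>P)"
    proof (rule sm(4))
      fix u assume "u \<in> T k ` space P"
      then have "s \<le> u" using ap(2)[of k] by auto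
      then have "A \<in> sets (F u)" using A sets_F_mono[of s u] by auto
      then show "A \<inter> {\<omega> \<in> space P. T k \<omega> = u} \<in> sets (F u)" using ap(4) by auto
    qed
  qed
qed

text \<open>An event of \<open>F s\<close> is split according to \<open>s < S\<close>. Where
  \<open>S\<close> is still to come, sampling applies between \<open>s\<close> and \<open>t\<close>;
  elsewhere the stopped process no longer moves after \<open>s\<close>.\<close>

lemma martingale_stopped:
  assumes M: "martingale P F M" and cont: "cont_paths P M"
    and S: "stopping_time F S" "\<And>\<omega>. \<omega> \<in> space P \<Longrightarrow> 0 \<le> S \<omega>"
  shows "martingale P F (\<lambda>t \<omega>. M (min t (S \<omega>)) \<omega>)"
proof (rule martingaleI)
  have st: "stopping_time F (\<lambda>\<omega>. min t (S \<omega>))" for t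
    by (intro stopping_time_min stopping_time_const S)
  note sm = cont_sampling[OF M cont st, of 0]
  show "adapted F (\<lambda>t \<omega>. M (min t (S \<omega>)) \<omega>)"
    unfolding adapted_def using sm(2) S(2) by auto
  show int: "integrable P (\<lambda>\<omega>. M (min t (S \<omega>)) \<omega>)" if "0 \<le> t" for t
    using that S(2) by (intro sm(1)[of t t]) auto
  fix s t A assume st: "0 \<le> s" "s \<le> t" and A: "A \<in> sets (F s)"
  let ?B = "{\<omega>\<in>space P. s < S \<omega>}"
  have B: "?B \<in> sets (F s)"
    using stopping_timeD2[OF S(1), of s] by (simp add: pred_def space_F)
  have AB: "A \<inter> ?B \<in> sets (F s)" "A - ?B \<in> sets (F s)" using A B by auto
  then have AB': "A \<inter> ?B \<in> sets P" "A - ?B \<in> sets P" using sets_F_subset by auto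
  have split: "(\<integral>\<omega>. indicator A \<omega> * f \<omega> \<partial>P) = (\<integral>\<omega>. indicator (A \<inter> ?B) \<omega> * f \<omega> \<partial>P) + (\<integral>\<omega>. indicator (A - ?B) \<omega> * f \<omega> \<partial>P)"
    if "integrable P f" for f :: "'a \<Rightarrow> real"
  proof (subst Bochner_Integration.integral_add[symmetric])
    show "integrable P (\<lambda>\<omega>. indicator (A \<inter> ?B) \<omega> * f \<omega>)" "integrable P (\<lambda>\<omega>. indicator (A - ?B) \<omega> * f \<omega>)"
      using integrable_mult_indicator[OF AB'(1) that] integrable_mult_indicator[OF AB'(2) that] by auto
  qed (auto intro!: Bochner_Integration.integral_cong simp: indicator_def)
  have SM: "stopping_time F (\<lambda>\<omega>. max s (min t (S \<omega>)))"
    by (intro stopping_time_max stopping_time_min stopping_time_const S)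
  \<comment> \<open>The outer maximum changes nothing on \<open>?B\<close>, but it gives the
    sampling time the lower bound \<open>s\<close> that \<open>cont_sampling\<close> requires for
    events of \<open>F s\<close>.\<close>
  have "(\<integral>\<omega>. indicator (A \<inter> ?B) \<omega> * M (min t (S \<omega>)) \<omega> \<partial>P)
      = (\<integral>\<omega>. indicator (A \<inter> ?B) \<omega> * M (max s (min t (S \<omega>))) \<omega> \<partial>P)"
    using st by (intro Bochner_Integration.integral_cong) (auto simp: indicator_def max_def)
  also have "\<dots> = (\<integral>\<omega>. indicator (A \<inter> ?B) \<omega> * M t \<omega> \<partial>P)"
    using st AB by (intro cont_sampling(3)[OF M cont SM]) auto
  also have "\<dots> = (\<integral>\<omega>. indicator (A \<inter> ?B) \<omega> * M s \<omega> \<partial>P)"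
    by (rule martingale_integral_eq[OF M st, where K=1]) (use AB in auto)
  also have "\<dots> = (\<integral>\<omega>. indicator (A \<inter> ?B) \<omega> * M (min s (S \<omega>)) \<omega> \<partial>P)"
    by (intro Bochner_Integration.integral_cong) (auto simp: indicator_def min_def)
  finally have "(\<integral>\<omega>. indicator (A \<inter> ?B) \<omega> * M (min t (S \<omega>)) \<omega> \<partial>P)
     = (\<integral>\<omega>. indicator (A \<inter> ?B) \<omega> * M (min s (S \<omega>)) \<omega> \<partial>P)" .
  moreover have "(\<integral>\<omega>. indicator (A - ?B) \<omega> * M (min t (S \<omega>)) \<omega> \<partial>P)
     = (\<integral>\<omega>. indicator (A - ?B) \<omega> * M (min s (S \<omega>)) \<omega> \<partial>P)"
  proof (intro Bochner_Integration.integral_cong refl)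
    fix \<omega> assume "\<omega> \<in> space P"
    then have "S \<omega> \<le> s" if "\<omega> \<in> A - ?B" using that by auto
    then have "min t (S \<omega>) = min s (S \<omega>)" if "\<omega> \<in> A - ?B" using that st by simp
    then show "indicator (A - ?B) \<omega> * M (min t (S \<omega>)) \<omega> = indicator (A - ?B) \<omega> * M (min s (S \<omega>)) \<omega>"
      by (cases "\<omega> \<in> A - ?B") auto
  qed
  ultimately show "(\<integral>\<omega>. indicator A \<omega> * M (min t (S \<omega>)) \<omega> \<partial>P) = (\<integral>\<omega>. indicator A \<omega> * M (min s (S \<omega>)) \<omega> \<partial>P)"
    using split int st by simp
qed

end

section \<open>Continuous local martingales\<close>

text \<open>The weight of a term looks only at earlier terms. It is 1 until the partial sums have
  passed \<open>C\<close> and 0 from then on, so the last term counted overshoots \<open>C\<close>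
  by at most \<open>b\<close>.\<close>

lemma stopped_sum_le:
  fixes x :: "nat \<Rightarrow> real"
  assumes "\<And>i. 0 \<le> x i" "\<And>i. x i \<le> b" "0 \<le> C"
  shows "(\<Sum>j<n. of_bool ((\<Sum>i<j. x i) \<le> C) * x j) \<le> C + b"
proof -
  have b: "0 \<le> b" using assms(1)[of 0] assms(2)[of 0] by linarith
  \<comment> \<open>Strengthened by the full partial sum: as long as that is at most
    \<open>C\<close>, adding one more term stays below \<open>C + b\<close>.\<close>
  have "(\<Sum>j<n. of_bool ((\<Sum>i<j. x i) \<le> C) * x j) \<le> min (\<Sum>j<n. x j) (C + b)"
  proof (induction n)
    case (Suc n)
    then show ?case using assms(1)[of n] assms(2)[of n] by (auto simp: min_def split: if_splits)
  qed (use assms(3) b in auto)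
  then show ?thesis by simp
qed

context filtered_prob_space
begin

section \<open>Algebra of adapted, continuous and martingale processes\<close>

lemma adapted_lincomb: "adapted F M \<Longrightarrow> adapted F N \<Longrightarrow> adapted F (\<lambda>t \<omega>. a * M t \<omega> + b * N t \<omega>)"
  unfolding adapted_def by (intro allI impI borel_measurable_add borel_measurable_times borel_measurable_const) auto

lemma cont_paths_lincomb: "cont_paths P M \<Longrightarrow> cont_paths P N \<Longrightarrow> cont_paths P (\<lambda>t \<omega>. a * M t \<omega> + b * N t \<omega>)"
  by (auto simp: cont_paths_def intro!: continuous_intros)

lemma adapted_mult: "adapted F M \<Longrightarrow> adapted F N \<Longrightarrow> adapted F (\<lambda>t \<omega>. M t \<omega> * N t \<omega>)"
  unfolding adapted_def by (intro allI impI borel_measurable_times) auto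

lemma cont_paths_mult: "cont_paths P M \<Longrightarrow> cont_paths P N \<Longrightarrow> cont_paths P (\<lambda>t \<omega>. M t \<omega> * N t \<omega>)"
  by (auto simp: cont_paths_def intro!: continuous_intros)

lemma martingale_lincomb:
  assumes M: "martingale P F M" and N: "martingale P F N"
  shows "martingale P F (\<lambda>t \<omega>. a * M t \<omega> + b * N t \<omega>)"
proof (rule martingaleI)
  show "adapted F (\<lambda>t \<omega>. a * M t \<omega> + b * N t \<omega>)"
    using M N by (intro adapted_lincomb) (auto simp: martingale_def)
  show "integrable P (\<lambda>\<omega>. a * M t \<omega> + b * N t \<omega>)" if "0 \<le> t" for t
    using martingaleD(1)[OF M that] martingaleD(1)[OF N that] by simp
  fix s t A assume st: "0 \<le> s" "s \<le> t" and A: "A \<in> sets (F s)"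
  have AP: "A \<in> sets P" using A sets_F_subset by auto
  have *: "(\<integral>\<omega>. indicator A \<omega> * (a * M u \<omega> + b * N u \<omega>) \<partial>P)
    = a * (\<integral>\<omega>. indicator A \<omega> * M u \<omega> \<partial>P) + b * (\<integral>\<omega>. indicator A \<omega> * N u \<omega> \<partial>P)" if "0 \<le> u" for u
  proof -
    have "integrable P (\<lambda>\<omega>. indicator A \<omega> * M u \<omega>)" "integrable P (\<lambda>\<omega>. indicator A \<omega> * N u \<omega>)"
      using integrable_mult_indicator[OF AP martingaleD(1)[OF M that]]
        integrable_mult_indicator[OF AP martingaleD(1)[OF N that]] by auto
    then show ?thesis by (simp add: algebra_simps)
  qed
  have "(\<integral>\<omega>. indicator A \<omega> * M t \<omega> \<partial>P) = (\<integral>\<omega>. indicator A \<omega> * M s \<omega> \<partial>P)"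
    "(\<integral>\<omega>. indicator A \<omega> * N t \<omega> \<partial>P) = (\<integral>\<omega>. indicator A \<omega> * N s \<omega> \<partial>P)"
    using A by (auto intro!: martingale_integral_eq[OF M st, where K=1] martingale_integral_eq[OF N st, where K=1])
  then show "(\<integral>\<omega>. indicator A \<omega> * (a * M t \<omega> + b * N t \<omega>) \<partial>P)
    = (\<integral>\<omega>. indicator A \<omega> * (a * M s \<omega> + b * N s \<omega>) \<partial>P)"
    using * st by simp
qed

lemma martingale_initial_mult:
  assumes M: "martingale P F M" and \<xi>: "\<xi> \<in> borel_measurable (F 0)" "\<And>\<omega>. \<omega> \<in> space P \<Longrightarrow> \<bar>\<xi> \<omega>\<bar> \<le> K"
  shows "martingale P F (\<lambda>t \<omega>. \<xi> \<omega> * M t \<omega>)"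
proof (rule martingaleI)
  have \<xi>F: "\<xi> \<in> borel_measurable (F t)" if "0 \<le> t" for t using measurable_F_mono[OF that \<xi>(1)] .
  show "adapted F (\<lambda>t \<omega>. \<xi> \<omega> * M t \<omega>)"
    using M \<xi>F by (auto simp: martingale_def adapted_def)
  show "integrable P (\<lambda>\<omega>. \<xi> \<omega> * M t \<omega>)" if "0 \<le> t" for t
    using martingaleD(1)[OF M that] measurable_F_P[OF \<xi>(1)] \<xi>(2) by (rule integrable_bounded_mult)
  fix s t A assume st: "0 \<le> s" "s \<le> t" and A: "A \<in> sets (F s)"
  have "(\<integral>\<omega>. (indicator A \<omega> * \<xi> \<omega>) * M t \<omega> \<partial>P) = (\<integral>\<omega>. (indicator A \<omega> * \<xi> \<omega>) * M s \<omega> \<partial>P)"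
  proof (rule martingale_integral_eq[OF M st])
    show "(\<lambda>\<omega>. indicator A \<omega> * \<xi> \<omega>) \<in> borel_measurable (F s)" using A \<xi>F[OF st(1)] by auto
    show "\<bar>indicator A \<omega> * \<xi> \<omega>\<bar> \<le> \<bar>K\<bar>" if "\<omega> \<in> space P" for \<omega>
      using \<xi>(2)[OF that] by (auto simp: indicator_def)
  qed
  then show "(\<integral>\<omega>. indicator A \<omega> * (\<xi> \<omega> * M t \<omega>) \<partial>P) = (\<integral>\<omega>. indicator A \<omega> * (\<xi> \<omega> * M s \<omega>) \<partial>P)"
    by (simp add: mult.assoc)
qed

lemma martingale_cong:
  assumes M: "martingale P F M" and eq: "\<And>t \<omega>. 0 \<le> t \<Longrightarrow> \<omega> \<in> space P \<Longrightarrow> N t \<omega> = M t \<omega>"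
  shows "martingale P F N"
proof (rule martingaleI)
  show "adapted F N" unfolding adapted_def
  proof (intro allI impI)
    fix t :: real assume t: "0 \<le> t"
    have "N t \<in> borel_measurable (F t) \<longleftrightarrow> M t \<in> borel_measurable (F t)"
      using eq t by (intro measurable_cong) (simp add: space_F)
    then show "N t \<in> borel_measurable (F t)" using martingaleD(2)[OF M t] by simp
  qed
  show "integrable P (N t)" if "0 \<le> t" for t
    using martingaleD(1)[OF M that] eq[OF that] by (subst Bochner_Integration.integrable_cong) auto
  fix s t A assume st: "0 \<le> s" "s \<le> t" and A: "A \<in> sets (F s)"
  have "(\<integral>\<omega>. indicator A \<omega> * N u \<omega> \<partial>P) = (\<integral>\<omega>. indicator A \<omega> * M u \<omega> \<partial>P)" if "0 \<le> u" for u
    using eq that by (intro Bochner_Integration.integral_cong) auto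
  moreover have "(\<integral>\<omega>. indicator A \<omega> * M t \<omega> \<partial>P) = (\<integral>\<omega>. indicator A \<omega> * M s \<omega> \<partial>P)"
    using A by (intro martingale_integral_eq[OF M st, where K=1]) auto
  ultimately show "(\<integral>\<omega>. indicator A \<omega> * N t \<omega> \<partial>P) = (\<integral>\<omega>. indicator A \<omega> * N s \<omega> \<partial>P)"
    using st by simp
qed

lemma martingale_null:
  assumes ad: "adapted F U" and null: "\<And>t. 0 \<le> t \<Longrightarrow> AE \<omega> in P. U t \<omega> = 0"
  shows "martingale P F U"
proof (rule martingaleI)
  have meas: "U t \<in> borel_measurable P" if "0 \<le> t" for t
    using ad that measurable_F_P by (auto simp: adapted_def)
  show "integrable P (U t)" if "0 \<le> t" for t
    using integrable_cong_AE[OF meas[OF that] borel_measurable_const null[OF that]] by simp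
  fix s t A assume st: "0 \<le> s" "s \<le> t" and A: "A \<in> sets (F s)"
  have [measurable]: "A \<in> sets P" using A sets_F_subset by auto
  have "(\<integral>\<omega>. indicator A \<omega> * U u \<omega> \<partial>P) = 0" if "0 \<le> u" for u
  proof -
    have "(\<integral>\<omega>. indicator A \<omega> * U u \<omega> \<partial>P) = (\<integral>\<omega>. 0 \<partial>P)"
      using meas[OF that] null[OF that] by (intro integral_cong_AE) auto
    then show ?thesis by simp
  qed
  then show "(\<integral>\<omega>. indicator A \<omega> * U t \<omega> \<partial>P) = (\<integral>\<omega>. indicator A \<omega> * U s \<omega> \<partial>P)"
    using st by simp
qed (rule ad)

section \<open>Localization\<close>

text \<open>The existential in \<open>cont_local_martingale\<close> with its witness exposed, so
  that sequences of different processes can be combined.\<close>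

definition localizes :: "(real \<Rightarrow> 'a \<Rightarrow> real) \<Rightarrow> (nat \<Rightarrow> 'a \<Rightarrow> real) \<Rightarrow> bool" where
  "localizes M \<tau> \<longleftrightarrow>
     (\<forall>n. stopping_time F (\<tau> n) \<and> (\<forall>\<omega>\<in>space P. 0 \<le> \<tau> n \<omega>)) \<and>
     (AE \<omega> in P. incseq (\<lambda>n. \<tau> n \<omega>) \<and> filterlim (\<lambda>n. \<tau> n \<omega>) at_top sequentially) \<and>
     (\<forall>n. martingale P F (\<lambda>t \<omega>. M (min t (\<tau> n \<omega>)) \<omega> - M 0 \<omega>))"

lemma cont_local_martingale_iff:
  "cont_local_martingale P F M \<longleftrightarrow> adapted F M \<and> cont_paths P M \<and> (\<exists>\<tau>. localizes M \<tau>)"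
  by (simp add: cont_local_martingale_def localizes_def)

lemma cont_paths_stopped:
  assumes "cont_paths P M" "\<And>\<omega>. \<omega> \<in> space P \<Longrightarrow> 0 \<le> S \<omega>"
  shows "cont_paths P (\<lambda>t \<omega>. M (min t (S \<omega>)) \<omega> - M 0 \<omega>)"
  unfolding cont_paths_def
proof
  fix \<omega> assume \<omega>: "\<omega> \<in> space P"
  have "continuous_on {0..} (\<lambda>t. M (min t (S \<omega>)) \<omega>)"
    by (rule continuous_on_compose2[of "{0..}" "\<lambda>t. M t \<omega>"])
      (use assms \<omega> in \<open>auto simp: cont_paths_def intro!: continuous_intros\<close>)
  then show "continuous_on {0..} (\<lambda>t. M (min t (S \<omega>)) \<omega> - M 0 \<omega>)"
    by (intro continuous_intros)
qed

text \<open>This is the point where optional stopping enters. The extra time \<open>S\<close> is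
  later either a member of another localizing sequence or a hitting time.\<close>

lemma localizes_stopped:
  assumes "cont_paths P M" "localizes M \<tau>" "stopping_time F S" "\<And>\<omega>. \<omega> \<in> space P \<Longrightarrow> 0 \<le> S \<omega>"
  shows "martingale P F (\<lambda>t \<omega>. M (min t (min (\<tau> n \<omega>) (S \<omega>))) \<omega> - M 0 \<omega>)"
proof -
  have "martingale P F (\<lambda>t \<omega>. M (min (min t (S \<omega>)) (\<tau> n \<omega>)) \<omega> - M 0 \<omega>)"
    by (rule martingale_stopped[of "\<lambda>t \<omega>. M (min t (\<tau> n \<omega>)) \<omega> - M 0 \<omega>"])
      (use assms in \<open>auto simp: localizes_def intro!: cont_paths_stopped\<close>)
  then show ?thesis by (simp add: ac_simps)
qed

text \<open>Neither sequence need localize the other process, but the minimum of the two localizes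
  both by \<open>localizes_stopped\<close>.\<close>

lemma cont_local_martingale_lincomb:
  assumes M: "cont_local_martingale P F M" and N: "cont_local_martingale P F N"
  shows "cont_local_martingale P F (\<lambda>t \<omega>. a * M t \<omega> + b * N t \<omega>)"
proof -
  obtain \<tau> \<sigma> where \<tau>: "localizes M \<tau>" and \<sigma>: "localizes N \<sigma>"
    using M N by (auto simp: cont_local_martingale_iff)
  have cont: "cont_paths P M" "cont_paths P N" using M N by (auto simp: cont_local_martingale_iff)
  have st: "stopping_time F (\<tau> n)" "stopping_time F (\<sigma> n)" for n
    using \<tau> \<sigma> by (auto simp: localizes_def)
  have nn: "0 \<le> \<tau> n \<omega>" "0 \<le> \<sigma> n \<omega>" if "\<omega> \<in> space P" for n \<omega>
    using \<tau> \<sigma> that by (auto simp: localizes_def)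
  define \<rho> where "\<rho> n \<omega> = min (\<tau> n \<omega>) (\<sigma> n \<omega>)" for n \<omega>
  have "localizes (\<lambda>t \<omega>. a * M t \<omega> + b * N t \<omega>) \<rho>"
    unfolding localizes_def
  proof (intro conjI allI)
    show "stopping_time F (\<rho> n)" for n unfolding \<rho>_def by (intro stopping_time_min st)
    show "\<forall>\<omega>\<in>space P. 0 \<le> \<rho> n \<omega>" for n using nn by (auto simp: \<rho>_def)
    have "AE \<omega> in P. incseq (\<lambda>n. \<tau> n \<omega>) \<and> filterlim (\<lambda>n. \<tau> n \<omega>) at_top sequentially"
      "AE \<omega> in P. incseq (\<lambda>n. \<sigma> n \<omega>) \<and> filterlim (\<lambda>n. \<sigma> n \<omega>) at_top sequentially"
      using \<tau> \<sigma> by (auto simp: localizes_def)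
    then show "AE \<omega> in P. incseq (\<lambda>n. \<rho> n \<omega>) \<and> filterlim (\<lambda>n. \<rho> n \<omega>) at_top sequentially"
    proof eventually_elim
      case (elim \<omega>)
      have "incseq (\<lambda>n. \<rho> n \<omega>)" using elim unfolding \<rho>_def incseq_def by (meson min.mono)
      moreover have "filterlim (\<lambda>n. \<rho> n \<omega>) at_top sequentially"
        using elim unfolding \<rho>_def filterlim_at_top by (auto intro: eventually_conj)
      ultimately show ?case ..
    qed
    fix n
    have 1: "martingale P F (\<lambda>t \<omega>. M (min t (\<rho> n \<omega>)) \<omega> - M 0 \<omega>)"
      unfolding \<rho>_def by (rule localizes_stopped[OF cont(1) \<tau> st(2) nn(2)])
    have 2: "martingale P F (\<lambda>t \<omega>. N (min t (\<rho> n \<omega>)) \<omega> - N 0 \<omega>)"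
      using localizes_stopped[OF cont(2) \<sigma> st(1) nn(1), of n n] unfolding \<rho>_def by (simp add: min.commute)
    show "martingale P F (\<lambda>t \<omega>. a * M (min t (\<rho> n \<omega>)) \<omega> + b * N (min t (\<rho> n \<omega>)) \<omega> - (a * M 0 \<omega> + b * N 0 \<omega>))"
      using martingale_lincomb[OF 1 2, of a b] by (simp add: algebra_simps)
  qed
  then show ?thesis using M N unfolding cont_local_martingale_iff
    by (auto intro!: adapted_lincomb cont_paths_lincomb)
qed

text \<open>Differences of almost surely equal processes vanish only up to a null set; this puts
  them among the local martingales, with deterministic localizing times. Adaptedness is assumed
  since \<open>F\<close> need not contain the null sets.\<close>

lemma cont_local_martingale_null:
  assumes ad: "adapted F U" and cont: "cont_paths P U" and null: "AE \<omega> in P. \<forall>t\<ge>0. U t \<omega> = 0"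
  shows "cont_local_martingale P F U"
proof -
  have "localizes U (\<lambda>n \<omega>. real n)"
    unfolding localizes_def
  proof (intro conjI allI)
    show "AE \<omega> in P. incseq (\<lambda>n. real n) \<and> filterlim (\<lambda>n. real n) at_top sequentially"
      by (simp add: incseq_def filterlim_real_sequentially)
    fix n
    show "martingale P F (\<lambda>t \<omega>. U (min t (real n)) \<omega> - U 0 \<omega>)"
    proof (rule martingale_null)
      show "adapted F (\<lambda>t \<omega>. U (min t (real n)) \<omega> - U 0 \<omega>)"
        unfolding adapted_def
      proof (intro allI impI borel_measurable_diff)
        fix t :: real assume t: "0 \<le> t"
        show "U (min t (real n)) \<in> borel_measurable (F t)"
          by (rule measurable_F_mono[of "min t (real n)"]) (use ad t in \<open>simp_all add: adapted_def\<close>)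
        show "U 0 \<in> borel_measurable (F t)"
          by (rule measurable_F_mono[of 0]) (use ad t in \<open>simp_all add: adapted_def\<close>)
      qed
      show "AE \<omega> in P. U (min t (real n)) \<omega> - U 0 \<omega> = 0" if "0 \<le> t" for t
        using null by eventually_elim (use that in auto)
    qed
  qed (auto simp: stopping_time_const)
  then show ?thesis using ad cont unfolding cont_local_martingale_iff by auto
qed

text \<open>Since \<xi> is known at time 0, paths on which it is large can be stopped at once. The
  main use has \<xi> equal to the initial value of another local martingale, on which no
  integrability is imposed.\<close>

lemma cont_local_martingale_initial_mult:
  assumes M: "cont_local_martingale P F M" and \<xi>: "\<xi> \<in> borel_measurable (F 0)"
  shows "cont_local_martingale P F (\<lambda>t \<omega>. \<xi> \<omega> * M t \<omega>)"
proof -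
  obtain \<tau> where \<tau>: "localizes M \<tau>" using M by (auto simp: cont_local_martingale_iff)
  have st: "stopping_time F (\<tau> n)" for n using \<tau> by (auto simp: localizes_def)
  have nn: "0 \<le> \<tau> n \<omega>" if "\<omega> \<in> space P" for n \<omega> using \<tau> that by (auto simp: localizes_def)
  \<comment> \<open>Stopping at 0 makes the process vanish after its initial value is subtracted, so
    it amounts to the bounded weight \<open>of_bool (\<bar>\<xi> \<omega>\<bar> \<le> real n) *
    \<xi> \<omega>\<close>.\<close>
  define \<rho> where "\<rho> n \<omega> = (if \<bar>\<xi> \<omega>\<bar> \<le> real n then \<tau> n \<omega> else 0)" for n \<omega>
  have "localizes (\<lambda>t \<omega>. \<xi> \<omega> * M t \<omega>) \<rho>"
    unfolding localizes_def
  proof (intro conjI allI)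
    show nn\<rho>: "\<forall>\<omega>\<in>space P. 0 \<le> \<rho> n \<omega>" for n using nn by (auto simp: \<rho>_def)
    show "stopping_time F (\<rho> n)" for n
    proof (rule stopping_timeI)
      fix t
      show "Measurable.pred (F t) (\<lambda>\<omega>. \<rho> n \<omega> \<le> t)"
      proof (cases "0 \<le> t")
        case True
        have [measurable]: "\<xi> \<in> borel_measurable (F t)" by (rule measurable_F_mono[OF True \<xi>])
        have [measurable]: "Measurable.pred (F t) (\<lambda>\<omega>. \<tau> n \<omega> \<le> t)" using stopping_timeD[OF st] .
        have "(\<lambda>\<omega>. \<rho> n \<omega> \<le> t) = (\<lambda>\<omega>. \<bar>\<xi> \<omega>\<bar> \<le> real n \<longrightarrow> \<tau> n \<omega> \<le> t)"
          using True by (auto simp: \<rho>_def)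
        then show ?thesis by simp
      next
        case False
        have "Measurable.pred (F t) (\<lambda>\<omega>. \<rho> n \<omega> \<le> t) \<longleftrightarrow> Measurable.pred (F t) (\<lambda>\<omega>. False)"
          using nn\<rho>[of n] False by (intro measurable_cong) (fastforce simp: space_F)
        then show ?thesis by simp
      qed
    qed
    have "AE \<omega> in P. incseq (\<lambda>n. \<tau> n \<omega>) \<and> filterlim (\<lambda>n. \<tau> n \<omega>) at_top sequentially"
      using \<tau> by (auto simp: localizes_def)
    with AE_space show "AE \<omega> in P. incseq (\<lambda>n. \<rho> n \<omega>) \<and> filterlim (\<lambda>n. \<rho> n \<omega>) at_top sequentially"
    proof eventually_elim
      case (elim \<omega>)
      have "incseq (\<lambda>n. \<rho> n \<omega>)"
      proof (rule incseq_SucI)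
        fix n
        have "\<tau> n \<omega> \<le> \<tau> (Suc n) \<omega>" using elim by (auto simp: incseq_def)
        then show "\<rho> n \<omega> \<le> \<rho> (Suc n) \<omega>" using nn[OF elim(1), of "Suc n"] by (auto simp: \<rho>_def)
      qed
      moreover have "\<forall>\<^sub>F n in sequentially. \<tau> n \<omega> = \<rho> n \<omega>"
      proof (rule eventually_sequentiallyI[of "nat \<lceil>\<bar>\<xi> \<omega>\<bar>\<rceil>"])
        fix n assume "nat \<lceil>\<bar>\<xi> \<omega>\<bar>\<rceil> \<le> n"
        then have "\<bar>\<xi> \<omega>\<bar> \<le> real n" by linarith
        then show "\<tau> n \<omega> = \<rho> n \<omega>" by (simp add: \<rho>_def)
      qed
      then have "filterlim (\<lambda>n. \<rho> n \<omega>) at_top sequentially"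
        using elim(2) filterlim_cong[OF refl refl, of "\<lambda>n. \<tau> n \<omega>" "\<lambda>n. \<rho> n \<omega>"] by auto
      ultimately show ?case ..
    qed
    fix n
    have mart: "martingale P F (\<lambda>t \<omega>. M (min t (\<tau> n \<omega>)) \<omega> - M 0 \<omega>)"
      using \<tau> by (auto simp: localizes_def)
    have "martingale P F (\<lambda>t \<omega>. (of_bool (\<bar>\<xi> \<omega>\<bar> \<le> real n) * \<xi> \<omega>) * (M (min t (\<tau> n \<omega>)) \<omega> - M 0 \<omega>))"
    proof (rule martingale_initial_mult[OF mart])
      show "(\<lambda>\<omega>. of_bool (\<bar>\<xi> \<omega>\<bar> \<le> real n) * \<xi> \<omega>) \<in> borel_measurable (F 0)"
        using \<xi> by measurable
      show "\<bar>of_bool (\<bar>\<xi> \<omega>\<bar> \<le> real n) * \<xi> \<omega>\<bar> \<le> real n" for \<omega> by auto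
    qed
    then show "martingale P F (\<lambda>t \<omega>. \<xi> \<omega> * M (min t (\<rho> n \<omega>)) \<omega> - \<xi> \<omega> * M 0 \<omega>)"
      by (rule martingale_cong) (auto simp: \<rho>_def algebra_simps)
  qed
  moreover have "adapted F (\<lambda>t \<omega>. \<xi> \<omega> * M t \<omega>)"
    using M \<xi> measurable_F_mono[OF _ \<xi>] by (auto simp: cont_local_martingale_iff adapted_def)
  moreover have "cont_paths P (\<lambda>t \<omega>. \<xi> \<omega> * M t \<omega>)"
    using M by (auto simp: cont_local_martingale_iff cont_paths_def intro!: continuous_intros)
  ultimately show ?thesis unfolding cont_local_martingale_iff by auto
qed

text \<open>Each stopped square is a nonnegative martingale starting at 0; its expectation stays 0,
  so it vanishes almost surely.\<close>

lemma cont_local_martingale_square_null: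
  assumes W: "cont_local_martingale P F (\<lambda>t \<omega>. (W t \<omega>)\<^sup>2)" and W0: "\<And>\<omega>. \<omega> \<in> space P \<Longrightarrow> W 0 \<omega> = 0"
    and t: "0 \<le> t"
  shows "AE \<omega> in P. W t \<omega> = 0"
proof -
  obtain \<tau> where \<tau>: "localizes (\<lambda>t \<omega>. (W t \<omega>)\<^sup>2) \<tau>" using W by (auto simp: cont_local_martingale_iff)
  have "AE \<omega> in P. W (min t (\<tau> n \<omega>)) \<omega> = 0" for n
  proof -
    let ?N = "\<lambda>t \<omega>. (W (min t (\<tau> n \<omega>)) \<omega>)\<^sup>2 - (W 0 \<omega>)\<^sup>2"
    have m: "martingale P F ?N" using \<tau> by (auto simp: localizes_def)
    have "(\<integral>\<omega>. 1 * ?N t \<omega> \<partial>P) = (\<integral>\<omega>. 1 * ?N 0 \<omega> \<partial>P)"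
      by (rule martingale_integral_eq[OF m _ t, where K=1]) auto
    also have "\<dots> = (\<integral>\<omega>. 0 \<partial>P)"
      using \<tau> by (intro Bochner_Integration.integral_cong) (auto simp: localizes_def min_absorb1)
    finally have "(\<integral>\<omega>. ?N t \<omega> \<partial>P) = 0" by simp
    moreover have "AE \<omega> in P. 0 \<le> ?N t \<omega>" using W0 by (intro AE_I2) auto
    ultimately have "AE \<omega> in P. ?N t \<omega> = 0"
      using integral_nonneg_eq_0_iff_AE[OF martingaleD(1)[OF m t]] by blast
    with AE_space show ?thesis by eventually_elim (use W0 in auto)
  qed
  then have "AE \<omega> in P. \<forall>n. W (min t (\<tau> n \<omega>)) \<omega> = 0" by (simp add: AE_all_countable)
  moreover have "AE \<omega> in P. filterlim (\<lambda>n. \<tau> n \<omega>) at_top sequentially" using \<tau> by (auto simp: localizes_def)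
  ultimately show ?thesis
  proof eventually_elim
    case (elim \<omega>)
    then obtain n where "t \<le> \<tau> n \<omega>" unfolding filterlim_at_top eventually_sequentially by blast
    with elim(1) show ?case by (metis min_absorb1)
  qed
qed

section \<open>Hitting times of continuous processes\<close>

text \<open>Inserting \<open>T\<close> keeps the set nonempty, so the value is finite and is
  \<open>T\<close> if the level is not reached. By continuity the set is closed and the infimum is
  attained.\<close>

definition hitting :: "(real \<Rightarrow> 'a \<Rightarrow> real) \<Rightarrow> real \<Rightarrow> real \<Rightarrow> 'a \<Rightarrow> real" where
  "hitting B K T \<omega> = Inf (insert T {s\<in>{0..T}. K \<le> \<bar>B s \<omega>\<bar>})"

lemma hitting_in:
  assumes cont: "cont_paths P B" and \<omega>: "\<omega> \<in> space P" and T: "0 \<le> T"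
  shows "hitting B K T \<omega> \<in> insert T {s\<in>{0..T}. K \<le> \<bar>B s \<omega>\<bar>}"
  unfolding hitting_def
proof (rule closed_contains_Inf)
  have "continuous_on {0..T} (\<lambda>s. \<bar>B s \<omega>\<bar>)"
    using cont \<omega> by (auto simp: cont_paths_def intro!: continuous_intros elim!: continuous_on_subset)
  then have "closed {s\<in>{0..T}. K \<le> \<bar>B s \<omega>\<bar>}"
    using continuous_on_closed_Collect_le[OF continuous_on_const, of "{0..T}"] by auto
  then show "closed (insert T {s\<in>{0..T}. K \<le> \<bar>B s \<omega>\<bar>})" by (rule closed_insert)
  show "bdd_below (insert T {s\<in>{0..T}. K \<le> \<bar>B s \<omega>\<bar>})" by (rule bdd_belowI[of _ 0]) (use T in auto)
qed auto

lemma hitting_le: "0 \<le> s \<Longrightarrow> s \<le> T \<Longrightarrow> K \<le> \<bar>B s \<omega>\<bar> \<Longrightarrow> hitting B K T \<omega> \<le> s"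
  unfolding hitting_def by (rule cInf_lower) (auto intro!: bdd_belowI[of _ 0])

text \<open>Reaching the level by time \<open>u\<close> means that the maximum of the path over
  \<open>[0,u]\<close> is at least \<open>K\<close>. By continuity this is a countable condition on
  values up to \<open>u\<close>, hence an event of \<open>F u\<close> itself.\<close>

lemma stopping_time_hitting:
  assumes cont: "cont_paths P B" and ad: "adapted F B" and T: "0 \<le> T"
  shows "stopping_time F (hitting B K T)"
proof (rule stopping_timeI)
  fix u
  consider "u < 0" | "0 \<le> u" "u < T" | "T \<le> u" by linarith
  then show "Measurable.pred (F u) (\<lambda>\<omega>. hitting B K T \<omega> \<le> u)"
  proof cases
    case 1
    have "\<not> hitting B K T \<omega> \<le> u" if "\<omega> \<in> space P" for \<omega>
      using hitting_in[OF cont that T, of K] 1 T by auto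
    then have "Measurable.pred (F u) (\<lambda>\<omega>. hitting B K T \<omega> \<le> u) \<longleftrightarrow> Measurable.pred (F u) (\<lambda>\<omega>. False)"
      by (intro measurable_cong) (simp add: space_F)
    then show ?thesis by simp
  next
    case 3
    have "hitting B K T \<omega> \<le> u" if "\<omega> \<in> space P" for \<omega>
      using hitting_in[OF cont that T, of K] 3 by auto
    then have "Measurable.pred (F u) (\<lambda>\<omega>. hitting B K T \<omega> \<le> u) \<longleftrightarrow> Measurable.pred (F u) (\<lambda>\<omega>. True)"
      by (intro measurable_cong) (simp add: space_F)
    then show ?thesis by simp
  next
    case 2
    \<comment> \<open>Scaling by \<open>u\<close> turns one fixed countable set into dense times of
      \<open>[0,u]\<close>. The level is relaxed by \<open>1 / real (Suc n)\<close> because it may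
      be reached at none of these times.\<close>
    let ?Q = "\<rat> \<inter> {0..1::real}"
    have eq: "hitting B K T \<omega> \<le> u \<longleftrightarrow> (\<forall>n. \<exists>q\<in>?Q. K - 1 / real (Suc n) < \<bar>B (u * q) \<omega>\<bar>)"
      if \<omega>: "\<omega> \<in> space P" for \<omega>
    proof
      have c: "continuous_on {0..u} (\<lambda>s. \<bar>B s \<omega>\<bar>)"
        using cont \<omega> by (auto simp: cont_paths_def intro!: continuous_intros elim!: continuous_on_subset)
      {
        assume "hitting B K T \<omega> \<le> u"
        then obtain s where s: "0 \<le> s" "s \<le> u" "K \<le> \<bar>B s \<omega>\<bar>"
          using hitting_in[OF cont \<omega> T, of K] 2 by fastforce
        obtain r where r: "r \<in> {0..1}" "s = u * r"
        proof (cases "u = 0")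
          case True
          with s show ?thesis by (intro that[of 0]) auto
        next
          case False
          with s 2 show ?thesis by (intro that[of "s / u"]) auto
        qed
        have c': "continuous_on {0..1} (\<lambda>q. \<bar>B (u * q) \<omega>\<bar>)"
          by (rule continuous_on_compose2[OF c])
            (use 2 in \<open>auto intro!: continuous_intros mult_left_le\<close>)
        show "\<forall>n. \<exists>q\<in>?Q. K - 1 / real (Suc n) < \<bar>B (u * q) \<omega>\<bar>"
        proof
          fix n
          have "K - 1 / real (Suc n) < K" by simp
          then have "K - 1 / real (Suc n) < \<bar>B s \<omega>\<bar>" using s(3) by (rule less_le_trans)
          then have "0 < \<bar>B (u * r) \<omega>\<bar> - (K - 1 / real (Suc n))" using r by simp
          then obtain d where d: "d > 0" "\<And>q. q \<in> {0..1} \<Longrightarrow> dist q r < d \<Longrightarrow>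
              dist \<bar>B (u * q) \<omega>\<bar> \<bar>B (u * r) \<omega>\<bar> < \<bar>B (u * r) \<omega>\<bar> - (K - 1 / real (Suc n))"
            using c' r(1) unfolding continuous_on_iff by metis
          have "max 0 (r - d) < min 1 (r + d)" using d r by auto
          then obtain q where q: "q \<in> \<rat>" "max 0 (r - d) < q" "q < min 1 (r + d)" using Rats_dense_in_real by blast
          then show "\<exists>q\<in>?Q. K - 1 / real (Suc n) < \<bar>B (u * q) \<omega>\<bar>"
            using d(2)[of q] by (intro bexI[of _ q]) (auto simp: dist_real_def abs_less_iff simp del: of_nat_Suc)
        qed
      }
      \<comment> \<open>Conversely, the maximum over \<open>[0,u]\<close> is attained and is at
        least every \<open>K - 1 / real (Suc n)\<close>, hence at least \<open>K\<close>.\<close>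
      assume R: "\<forall>n. \<exists>q\<in>?Q. K - 1 / real (Suc n) < \<bar>B (u * q) \<omega>\<bar>"
      obtain s where s: "s \<in> {0..u}" "\<And>v. v \<in> {0..u} \<Longrightarrow> \<bar>B v \<omega>\<bar> \<le> \<bar>B s \<omega>\<bar>"
        using continuous_attains_sup[OF _ _ c] 2 by auto
      have "K - 1 / real (Suc n) \<le> \<bar>B s \<omega>\<bar>" for n
      proof -
        obtain q where "q \<in> ?Q" "K - 1 / real (Suc n) < \<bar>B (u * q) \<omega>\<bar>" using R by blast
        moreover from this have "u * q \<in> {0..u}" using 2 by (auto intro!: mult_left_le)
        ultimately show ?thesis using s(2)[of "u * q"] by linarith
      qed
      moreover have "(\<lambda>n. K - 1 / real (Suc n)) \<longlonglongrightarrow> K"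
        using tendsto_diff[OF tendsto_const LIMSEQ_inverse_real_of_nat, of K] by (simp add: inverse_eq_divide)
      ultimately have "K \<le> \<bar>B s \<omega>\<bar>" by (intro LIMSEQ_le_const2) auto
      then show "hitting B K T \<omega> \<le> u" using hitting_le[of s T K B \<omega>] s 2 by auto
    qed
    have meas: "B (u * q) \<in> borel_measurable (F u)" if "q \<in> ?Q" for q
      using ad that 2 by (intro measurable_F_mono[of "u * q" u]) (auto simp: adapted_def intro!: mult_left_le)
    have "{\<omega> \<in> space (F u). \<exists>q\<in>?Q. K - 1 / real (Suc n) < \<bar>B (u * q) \<omega>\<bar>} \<in> sets (F u)" for n
    proof (rule sets.sets_Collect_countable_Ex')
      show "countable ?Q" by (intro countable_Int1 countable_rat)
      fix q assume "q \<in> ?Q"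
      then have [measurable]: "B (u * q) \<in> borel_measurable (F u)" by (rule meas)
      show "{\<omega> \<in> space (F u). K - 1 / real (Suc n) < \<bar>B (u * q) \<omega>\<bar>} \<in> sets (F u)" by measurable
    qed
    then have "Measurable.pred (F u) (\<lambda>\<omega>. \<forall>n. \<exists>q\<in>?Q. K - 1 / real (Suc n) < \<bar>B (u * q) \<omega>\<bar>)"
      unfolding pred_def by (rule sets.sets_Collect_countable_All)
    moreover have "Measurable.pred (F u) (\<lambda>\<omega>. hitting B K T \<omega> \<le> u)
      \<longleftrightarrow> Measurable.pred (F u) (\<lambda>\<omega>. \<forall>n. \<exists>q\<in>?Q. K - 1 / real (Suc n) < \<bar>B (u * q) \<omega>\<bar>)"
      using eq by (intro measurable_cong) (simp add: space_F)
    ultimately show ?thesis by simp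
  qed
qed

text \<open>A continuous path starting at 0 cannot skip the level: were it above \<open>K\<close> at
  time \<open>s\<close>, it would have been at \<open>K\<close> strictly earlier and the hitting
  time would have passed.\<close>

lemma bounded_until_hitting:
  assumes cont: "cont_paths P B" and \<omega>: "\<omega> \<in> space P" and T: "0 \<le> T"
    and B0: "B 0 \<omega> = 0" and K: "0 \<le> K" and s: "0 \<le> s" "s \<le> hitting B K T \<omega>"
  shows "\<bar>B s \<omega>\<bar> \<le> K"
proof (rule ccontr)
  assume "\<not> \<bar>B s \<omega>\<bar> \<le> K"
  moreover have "continuous_on {0..s} (\<lambda>s. \<bar>B s \<omega>\<bar>)"
    using cont \<omega> by (auto simp: cont_paths_def intro!: continuous_intros elim!: continuous_on_subset)
  ultimately obtain r where r: "0 \<le> r" "r \<le> s" "\<bar>B r \<omega>\<bar> = K"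
    using IVT'[of "\<lambda>s. \<bar>B s \<omega>\<bar>" 0 K s] B0 K s by auto
  have "s \<le> T" using s hitting_in[OF cont \<omega> T, of K] by auto
  then have "hitting B K T \<omega> \<le> r" using r by (intro hitting_le) auto
  then have "r = s" using r(2) s(2) by linarith
  then show False using r(3) \<open>\<not> \<bar>B s \<omega>\<bar> \<le> K\<close> by simp
qed

section \<open>Martingales with paths of bounded variation\<close>

text \<open>Orthogonality of increments for a martingale transform: \<open>H j\<close> is known at
  time \<open>g j\<close>, before the increment \<open>\<Delta> j\<close>, so cross terms integrate
  to 0. As \<open>H j\<close> is 0 or 1, squaring leaves it unchanged.\<close>

lemma discrete_square_bound:
  assumes M: "martingale P F M" and bd: "\<And>s \<omega>. 0 \<le> s \<Longrightarrow> \<omega> \<in> space P \<Longrightarrow> \<bar>M s \<omega>\<bar> \<le> K"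
    and g: "incseq g" "0 \<le> g 0" and C: "0 \<le> C"
  defines "\<Delta> \<equiv> \<lambda>j \<omega>. M (g (Suc j)) \<omega> - M (g j) \<omega>"
  defines "H \<equiv> \<lambda>j \<omega>. of_bool ((\<Sum>i<j. \<bar>\<Delta> i \<omega>\<bar>) \<le> C)"
  shows "integrable P (\<lambda>\<omega>. (\<Sum>j<n. H j \<omega> * \<Delta> j \<omega>)\<^sup>2)"
    and "integrable P (\<lambda>\<omega>. \<Sum>j<n. H j \<omega> * (\<Delta> j \<omega>)\<^sup>2)"
    and "(\<integral>\<omega>. (\<Sum>j<n. H j \<omega> * \<Delta> j \<omega>)\<^sup>2 \<partial>P) = (\<integral>\<omega>. (\<Sum>j<n. H j \<omega> * (\<Delta> j \<omega>)\<^sup>2) \<partial>P)"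
proof -
  have g0: "0 \<le> g j" for j using g incseqD[OF g(1), of 0 j] by simp
  have gS: "g j \<le> g (Suc j)" for j using g by (auto simp: incseq_def)
  have K0: "0 \<le> K" using bd[of 0] not_empty by fastforce
  have Mm: "M (g i) \<in> borel_measurable (F (g j))" if "i \<le> j" for i j
    using measurable_F_mono[OF incseqD[OF g(1) that]] martingaleD(2)[OF M g0] by blast
  have \<Delta>m: "\<Delta> i \<in> borel_measurable (F (g j))" if "i < j" for i j
    unfolding \<Delta>_def using that by (intro borel_measurable_diff Mm) auto
  have Hm: "H j \<in> borel_measurable (F (g j))" for j
  proof -
    have "(\<lambda>\<omega>. \<Sum>i<j. \<bar>\<Delta> i \<omega>\<bar>) \<in> borel_measurable (F (g j))"
      using \<Delta>m by (intro borel_measurable_sum borel_measurable_abs) auto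
    then show ?thesis unfolding H_def by measurable
  qed
  have Sm: "(\<lambda>\<omega>. \<Sum>i<j. H i \<omega> * \<Delta> i \<omega>) \<in> borel_measurable (F (g j))" for j
  proof (intro borel_measurable_sum borel_measurable_times)
    fix i assume "i \<in> {..<j}"
    then show "\<Delta> i \<in> borel_measurable (F (g j))" "H i \<in> borel_measurable (F (g j))"
      using \<Delta>m[of i j] measurable_F_mono[OF incseqD[OF g(1)] Hm, of i j] by auto
  qed
  have \<Delta>b: "\<bar>\<Delta> j \<omega>\<bar> \<le> 2 * K" if "\<omega> \<in> space P" for j \<omega>
    using bd[OF g0 that, of "Suc j"] bd[OF g0 that, of j] unfolding \<Delta>_def by linarith
  have Hb: "\<bar>H j \<omega>\<bar> \<le> 1" for j \<omega> by (auto simp: H_def)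
  have HD: "\<bar>H j \<omega> * \<Delta> j \<omega>\<bar> \<le> 2 * K" if "\<omega> \<in> space P" for j \<omega>
    using mult_mono[OF Hb \<Delta>b[OF that], of j j \<omega>] by (simp add: abs_mult)
  have Sb: "\<bar>\<Sum>i<j. H i \<omega> * \<Delta> i \<omega>\<bar> \<le> real j * (2 * K)" if "\<omega> \<in> space P" for j \<omega>
    using sum_norm_bound[of "{..<j}" "\<lambda>i. H i \<omega> * \<Delta> i \<omega>" "2 * K"] HD[OF that] by simp
  have \<Delta>P: "\<Delta> i \<in> borel_measurable P" "H i \<in> borel_measurable P" for i
    using \<Delta>m[of i "Suc i"] Hm[of i] measurable_F_P by blast+
  have SP: "(\<lambda>\<omega>. \<Sum>i<j. H i \<omega> * \<Delta> i \<omega>) \<in> borel_measurable P" for j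
    using Sm measurable_F_P by blast
  note [measurable] = \<Delta>P SP
  show int1: "integrable P (\<lambda>\<omega>. (\<Sum>j<n. H j \<omega> * \<Delta> j \<omega>)\<^sup>2)" for n
  proof (rule integrable_const_bound[where B="(real n * (2 * K))\<^sup>2"])
    show "AE \<omega> in P. norm ((\<Sum>j<n. H j \<omega> * \<Delta> j \<omega>)\<^sup>2) \<le> (real n * (2 * K))\<^sup>2"
    proof (intro AE_I2)
      fix \<omega> assume "\<omega> \<in> space P"
      from power_mono[OF Sb[OF this, of n] abs_ge_zero, of 2]
      show "norm ((\<Sum>j<n. H j \<omega> * \<Delta> j \<omega>)\<^sup>2) \<le> (real n * (2 * K))\<^sup>2" by simp
    qed
  qed measurable
  have int2: "integrable P (\<lambda>\<omega>. H j \<omega> * (\<Delta> j \<omega>)\<^sup>2)" for j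
  proof (rule integrable_const_bound[where B="(2 * K)\<^sup>2"])
    show "AE \<omega> in P. norm (H j \<omega> * (\<Delta> j \<omega>)\<^sup>2) \<le> (2 * K)\<^sup>2"
    proof (intro AE_I2)
      fix \<omega> assume "\<omega> \<in> space P"
      from power_mono[OF \<Delta>b[OF this, of j] abs_ge_zero, of 2]
      show "norm (H j \<omega> * (\<Delta> j \<omega>)\<^sup>2) \<le> (2 * K)\<^sup>2" by (auto simp: H_def)
    qed
  qed measurable
  show "integrable P (\<lambda>\<omega>. \<Sum>j<n. H j \<omega> * (\<Delta> j \<omega>)\<^sup>2)"
    using int2 by (intro Bochner_Integration.integrable_sum)
  show "(\<integral>\<omega>. (\<Sum>j<n. H j \<omega> * \<Delta> j \<omega>)\<^sup>2 \<partial>P) = (\<integral>\<omega>. (\<Sum>j<n. H j \<omega> * (\<Delta> j \<omega>)\<^sup>2) \<partial>P)"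
  proof (induction n)
    case (Suc n)
    \<comment> \<open>The factor of the new increment in the cross term of the square; it is bounded
      and known at time \<open>g n\<close>.\<close>
    define \<xi> where "\<xi> \<omega> = 2 * (\<Sum>j<n. H j \<omega> * \<Delta> j \<omega>) * H n \<omega>" for \<omega>
    have \<xi>m: "\<xi> \<in> borel_measurable (F (g n))"
      unfolding \<xi>_def by (intro borel_measurable_times borel_measurable_const Sm Hm)
    have \<xi>b: "\<bar>\<xi> \<omega>\<bar> \<le> 2 * (real n * (2 * K))" if "\<omega> \<in> space P" for \<omega>
      using mult_mono[OF Sb[OF that] Hb, of n n \<omega>] K0 by (simp add: \<xi>_def abs_mult mult_ac)
    have i\<xi>: "integrable P (\<lambda>\<omega>. \<xi> \<omega> * M (g j) \<omega>)" for j
      using martingaleD(1)[OF M g0] measurable_F_P[OF \<xi>m] \<xi>b by (rule integrable_bounded_mult)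
    have cross: "(\<integral>\<omega>. \<xi> \<omega> * M (g (Suc n)) \<omega> - \<xi> \<omega> * M (g n) \<omega> \<partial>P) = 0"
      using martingale_integral_eq[OF M g0 gS \<xi>m \<xi>b] i\<xi> by simp
    have "(\<integral>\<omega>. (\<Sum>j<Suc n. H j \<omega> * \<Delta> j \<omega>)\<^sup>2 \<partial>P)
      = (\<integral>\<omega>. ((\<Sum>j<n. H j \<omega> * \<Delta> j \<omega>)\<^sup>2 + (\<xi> \<omega> * M (g (Suc n)) \<omega> - \<xi> \<omega> * M (g n) \<omega>)) + H n \<omega> * (\<Delta> n \<omega>)\<^sup>2 \<partial>P)"
    proof (intro Bochner_Integration.integral_cong refl)
      fix \<omega>
      have "(H n \<omega>)\<^sup>2 = H n \<omega>" by (simp add: H_def)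
      then have "(H n \<omega> * \<Delta> n \<omega>)\<^sup>2 = H n \<omega> * (\<Delta> n \<omega>)\<^sup>2" by (simp add: power_mult_distrib)
      moreover have "\<xi> \<omega> * M (g (Suc n)) \<omega> - \<xi> \<omega> * M (g n) \<omega> = 2 * (\<Sum>j<n. H j \<omega> * \<Delta> j \<omega>) * (H n \<omega> * \<Delta> n \<omega>)"
        by (simp add: \<xi>_def \<Delta>_def algebra_simps)
      ultimately show "(\<Sum>j<Suc n. H j \<omega> * \<Delta> j \<omega>)\<^sup>2
        = ((\<Sum>j<n. H j \<omega> * \<Delta> j \<omega>)\<^sup>2 + (\<xi> \<omega> * M (g (Suc n)) \<omega> - \<xi> \<omega> * M (g n) \<omega>)) + H n \<omega> * (\<Delta> n \<omega>)\<^sup>2"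
        by (simp add: power2_sum)
    qed
    also have "\<dots> = (\<integral>\<omega>. (\<Sum>j<n. H j \<omega> * \<Delta> j \<omega>)\<^sup>2 \<partial>P) + (\<integral>\<omega>. H n \<omega> * (\<Delta> n \<omega>)\<^sup>2 \<partial>P)"
      using int1 int2 i\<xi> cross by simp
    also have "\<dots> = (\<integral>\<omega>. (\<Sum>j<Suc n. H j \<omega> * (\<Delta> j \<omega>)\<^sup>2) \<partial>P)"
      using int2 Suc by simp
    finally show ?case .
  qed simp
qed

text \<open>Stopping the sums at the last grid point where the discrete variation is at most \<open>c\<close> makes their second
  moment at most \<open>(c + 2 K) E W\<close>, with \<open>W\<close> the largest increment over the grid. This tends to 0 as
  the mesh does, and on paths of variation at most \<open>c\<close> nothing has been stopped. In this way the
  variation process itself is never needed, neither its measurability nor a stopping time built from it.\<close>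

lemma bounded_bv_martingale_null:
  assumes M: "martingale P F M" and cont: "cont_paths P M"
    and bd: "\<And>s \<omega>. 0 \<le> s \<Longrightarrow> \<omega> \<in> space P \<Longrightarrow> \<bar>M s \<omega>\<bar> \<le> K"
    and M0: "\<And>\<omega>. \<omega> \<in> space P \<Longrightarrow> M 0 \<omega> = 0"
    and bv: "\<And>\<omega>. \<omega> \<in> space P \<Longrightarrow> bdd_above (variation_sums (\<lambda>t. M t \<omega>) t)" and t: "0 \<le> t"
  shows "AE \<omega> in P. M t \<omega> = 0"
proof -
  \<comment> \<open>Equal steps that reach \<open>t\<close> at index \<open>Suc m\<close>. The
    minimum freezes the sequence there, since variation sums are indexed by infinite increasing
    sequences.\<close>
  define g where "g m j = real (min j (Suc m)) * t / real (Suc m)" for m j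
  define \<Delta> where "\<Delta> m j \<omega> = M (g m (Suc j)) \<omega> - M (g m j) \<omega>" for m j \<omega>
  have g_inc: "incseq (g m)" for m
    unfolding g_def incseq_def using t
    by (auto intro!: divide_right_mono mult_right_mono simp del: of_nat_Suc)
  have g0: "g m 0 = 0" and gE: "g m (Suc m) = t" for m by (auto simp: g_def simp del: of_nat_Suc)
  have gin: "0 \<le> g m j" "g m j \<le> t" for m j
  proof -
    show "0 \<le> g m j" using t by (simp add: g_def)
    have "g m j = g m (min j (Suc m))" by (simp add: g_def)
    also have "\<dots> \<le> g m (Suc m)" by (rule incseqD[OF g_inc]) simp
    finally show "g m j \<le> t" by (simp add: gE)
  qed
  have gstep: "g m (Suc j) - g m j \<le> t / real (Suc m)" for m j
  proof (cases "j \<le> m")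
    case True
    then show ?thesis by (simp add: g_def diff_divide_distrib[symmetric] algebra_simps)
  next
    case False
    then show ?thesis using t by (simp add: g_def min_absorb2)
  qed
  have K0: "0 \<le> K" using bd[of 0] not_empty by fastforce
  have \<Delta>b: "\<bar>\<Delta> m j \<omega>\<bar> \<le> 2 * K" if "\<omega> \<in> space P" for m j \<omega>
    using bd[OF gin(1) that, of m "Suc j"] bd[OF gin(1) that, of m j] unfolding \<Delta>_def by linarith
  define W where "W m \<omega> = Max ((\<lambda>j. \<bar>\<Delta> m j \<omega>\<bar>) ` {..m})" for m \<omega>
  have \<Delta>P: "\<Delta> m j \<in> borel_measurable P" for m j
    unfolding \<Delta>_def using martingaleD(1)[OF M gin(1)] by auto
  note [measurable] = \<Delta>P
  have WP[measurable]: "W m \<in> borel_measurable P" for m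
    unfolding W_def by measurable
  have W_ge: "\<bar>\<Delta> m j \<omega>\<bar> \<le> W m \<omega>" if "j \<le> m" for m j \<omega>
    unfolding W_def using that by (intro Max_ge) auto
  have W_obt: "\<exists>j. W m \<omega> = \<bar>\<Delta> m j \<omega>\<bar>" for m \<omega>
  proof -
    have "W m \<omega> \<in> (\<lambda>j. \<bar>\<Delta> m j \<omega>\<bar>) ` {..m}" unfolding W_def by (intro Max_in) auto
    then show ?thesis by auto
  qed
  have W0: "0 \<le> W m \<omega>" for m \<omega> using W_obt[of m \<omega>] by auto
  have Wb: "W m \<omega> \<le> 2 * K" if "\<omega> \<in> space P" for m \<omega> using W_obt[of m \<omega>] \<Delta>b[OF that] by auto
  have Wlim: "(\<lambda>m. W m \<omega>) \<longlonglongrightarrow> 0" if \<omega>: "\<omega> \<in> space P" for \<omega>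
  proof (rule LIMSEQ_I)
    fix e :: real assume e: "0 < e"
    have "uniformly_continuous_on {0..t} (\<lambda>s. M s \<omega>)"
      using cont \<omega> by (intro compact_uniformly_continuous) (auto simp: cont_paths_def elim!: continuous_on_subset)
    then obtain d where d: "d > 0" "\<And>a b. a \<in> {0..t} \<Longrightarrow> b \<in> {0..t} \<Longrightarrow> dist a b < d \<Longrightarrow> dist (M a \<omega>) (M b \<omega>) < e"
      using e unfolding uniformly_continuous_on_def by metis
    obtain N :: nat where N: "t / d < real N" using reals_Archimedean2 by blast
    show "\<exists>N. \<forall>m\<ge>N. norm (W m \<omega> - 0) < e"
    proof (intro exI allI impI)
      fix m assume "N \<le> m"
      then have "t / d < real (Suc m)" using N by linarith
      then have td: "t / real (Suc m) < d" using d(1) by (simp add: field_simps del: of_nat_Suc)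
      obtain j where j: "W m \<omega> = \<bar>\<Delta> m j \<omega>\<bar>" using W_obt by blast
      have "g m j \<le> g m (Suc j)" by (rule incseqD[OF g_inc]) simp
      then have "dist (g m (Suc j)) (g m j) < d" using gstep[of m j] td by (simp add: dist_real_def)
      then have "dist (M (g m (Suc j)) \<omega>) (M (g m j) \<omega>) < e" using gin by (intro d(2)) auto
      then show "norm (W m \<omega> - 0) < e" using j by (simp add: \<Delta>_def dist_real_def)
    qed
  qed
  \<comment> \<open>Only countably many grid sums are involved, so this is an event. Every path in
    the space lies in \<open>G c\<close> for some \<open>c\<close>, because its variation on
    \<open>[0,t]\<close> is bounded.\<close>
  define G where "G c = {\<omega>\<in>space P. \<forall>m. (\<Sum>j<Suc m. \<bar>\<Delta> m j \<omega>\<bar>) \<le> real c}" for c :: nat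
  have [measurable]: "G c \<in> sets P" for c unfolding G_def by measurable
  have MtP[measurable]: "M t \<in> borel_measurable P" using martingaleD(1)[OF M t] by auto
  have "AE \<omega> in P. \<omega> \<in> G c \<longrightarrow> M t \<omega> = 0" for c
  proof -
    define H where "H m j \<omega> = (of_bool ((\<Sum>i<j. \<bar>\<Delta> m i \<omega>\<bar>) \<le> real c) :: real)" for m j \<omega>
    have iG: "integrable P (\<lambda>\<omega>. indicator (G c) \<omega> * (M t \<omega>)\<^sup>2)"
    proof (rule integrable_const_bound[where B="K\<^sup>2"])
      show "AE \<omega> in P. norm (indicator (G c) \<omega> * (M t \<omega>)\<^sup>2) \<le> K\<^sup>2"
      proof (intro AE_I2)
        fix \<omega> assume "\<omega> \<in> space P"
        from power_mono[OF bd[OF t this] abs_ge_zero, of 2]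
        show "norm (indicator (G c) \<omega> * (M t \<omega>)\<^sup>2) \<le> K\<^sup>2" by (auto simp: indicator_def)
      qed
    qed measurable
    have le: "(\<integral>\<omega>. indicator (G c) \<omega> * (M t \<omega>)\<^sup>2 \<partial>P) \<le> (\<integral>\<omega>. (real c + 2 * K) * W m \<omega> \<partial>P)" for m
    proof -
      have ds: "integrable P (\<lambda>\<omega>. (\<Sum>j<Suc m. H m j \<omega> * \<Delta> m j \<omega>)\<^sup>2)"
        "integrable P (\<lambda>\<omega>. \<Sum>j<Suc m. H m j \<omega> * (\<Delta> m j \<omega>)\<^sup>2)"
        "(\<integral>\<omega>. (\<Sum>j<Suc m. H m j \<omega> * \<Delta> m j \<omega>)\<^sup>2 \<partial>P) = (\<integral>\<omega>. (\<Sum>j<Suc m. H m j \<omega> * (\<Delta> m j \<omega>)\<^sup>2) \<partial>P)"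
        unfolding H_def \<Delta>_def
        by (rule discrete_square_bound[OF M bd g_inc]; simp add: g0)+
      have "(\<integral>\<omega>. indicator (G c) \<omega> * (M t \<omega>)\<^sup>2 \<partial>P) \<le> (\<integral>\<omega>. (\<Sum>j<Suc m. H m j \<omega> * \<Delta> m j \<omega>)\<^sup>2 \<partial>P)"
      proof (rule integral_mono[OF iG ds(1)])
        fix \<omega> assume \<omega>: "\<omega> \<in> space P"
        show "indicator (G c) \<omega> * (M t \<omega>)\<^sup>2 \<le> (\<Sum>j<Suc m. H m j \<omega> * \<Delta> m j \<omega>)\<^sup>2"
        proof (cases "\<omega> \<in> G c")
          case True
          have "H m j \<omega> = 1" if "j < Suc m" for j
          proof -
            have "(\<Sum>i<j. \<bar>\<Delta> m i \<omega>\<bar>) \<le> (\<Sum>i<Suc m. \<bar>\<Delta> m i \<omega>\<bar>)"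
              using that by (intro sum_mono2) auto
            also have "\<dots> \<le> real c" using True by (auto simp: G_def)
            finally show ?thesis by (simp add: H_def)
          qed
          then have "(\<Sum>j<Suc m. H m j \<omega> * \<Delta> m j \<omega>) = (\<Sum>j<Suc m. \<Delta> m j \<omega>)" by (intro sum.cong) auto
          also have "\<dots> = M t \<omega>"
            unfolding \<Delta>_def using sum_lessThan_telescope[of "\<lambda>j. M (g m j) \<omega>" "Suc m"] M0[OF \<omega>] by (simp add: g0 gE)
          finally show ?thesis using True by simp
        qed simp
      qed
      also note ds(3)
      also have "(\<integral>\<omega>. (\<Sum>j<Suc m. H m j \<omega> * (\<Delta> m j \<omega>)\<^sup>2) \<partial>P) \<le> (\<integral>\<omega>. (real c + 2 * K) * W m \<omega> \<partial>P)"
      proof (rule integral_mono[OF ds(2)])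
        show "integrable P (\<lambda>\<omega>. (real c + 2 * K) * W m \<omega>)"
          using W0 Wb by (intro integrable_mult_right integrable_const_bound[where B="2 * K"]) auto
        fix \<omega> assume \<omega>: "\<omega> \<in> space P"
        have "(\<Sum>j<Suc m. H m j \<omega> * (\<Delta> m j \<omega>)\<^sup>2) \<le> (\<Sum>j<Suc m. (H m j \<omega> * \<bar>\<Delta> m j \<omega>\<bar>) * W m \<omega>)"
        proof (rule sum_mono)
          fix j assume "j \<in> {..<Suc m}"
          then have "\<bar>\<Delta> m j \<omega>\<bar> * \<bar>\<Delta> m j \<omega>\<bar> \<le> \<bar>\<Delta> m j \<omega>\<bar> * W m \<omega>"
            by (intro mult_left_mono W_ge) auto
          then show "H m j \<omega> * (\<Delta> m j \<omega>)\<^sup>2 \<le> (H m j \<omega> * \<bar>\<Delta> m j \<omega>\<bar>) * W m \<omega>"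
            by (auto simp: H_def power2_eq_square)
        qed
        also have "\<dots> = (\<Sum>j<Suc m. H m j \<omega> * \<bar>\<Delta> m j \<omega>\<bar>) * W m \<omega>" by (rule sum_distrib_right[symmetric])
        \<comment> \<open>The weighted variation passes \<open>c\<close> by at most one increment,
          and an increment is at most \<open>2 * K\<close> because \<open>M\<close> is bounded by
          \<open>K\<close>.\<close>
        also have "\<dots> \<le> (real c + 2 * K) * W m \<omega>"
          unfolding H_def using \<Delta>b[OF \<omega>] W0
          by (intro mult_right_mono stopped_sum_le[of "\<lambda>j. \<bar>\<Delta> m j \<omega>\<bar>"]) auto
        finally show "(\<Sum>j<Suc m. H m j \<omega> * (\<Delta> m j \<omega>)\<^sup>2) \<le> (real c + 2 * K) * W m \<omega>" .
      qed
      finally show ?thesis .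
    qed
    have "(\<lambda>m. \<integral>\<omega>. (real c + 2 * K) * W m \<omega> \<partial>P) \<longlonglongrightarrow> (\<integral>\<omega>. (real c + 2 * K) * 0 \<partial>P)"
    proof (rule integral_dominated_convergence[where w="\<lambda>_. (real c + 2 * K) * (2 * K)"])
      show "AE \<omega> in P. (\<lambda>m. (real c + 2 * K) * W m \<omega>) \<longlonglongrightarrow> (real c + 2 * K) * 0"
        by (intro AE_I2 tendsto_intros Wlim)
      show "AE \<omega> in P. norm ((real c + 2 * K) * W m \<omega>) \<le> (real c + 2 * K) * (2 * K)" for m
        using W0 Wb K0 by (intro AE_I2) (auto simp: abs_mult intro!: mult_left_mono)
    qed auto
    then have "(\<integral>\<omega>. indicator (G c) \<omega> * (M t \<omega>)\<^sup>2 \<partial>P) \<le> 0"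
      using le by (intro LIMSEQ_le_const) auto
    moreover have "0 \<le> (\<integral>\<omega>. indicator (G c) \<omega> * (M t \<omega>)\<^sup>2 \<partial>P)"
      by (intro Bochner_Integration.integral_nonneg) auto
    ultimately have "AE \<omega> in P. indicator (G c) \<omega> * (M t \<omega>)\<^sup>2 = 0"
      using integral_nonneg_eq_0_iff_AE[OF iG] by auto
    then show ?thesis by eventually_elim auto
  qed
  then have "AE \<omega> in P. \<forall>c. \<omega> \<in> G c \<longrightarrow> M t \<omega> = 0" by (intro AE_all_countable[THEN iffD2] allI)
  with AE_space show ?thesis
  proof eventually_elim
    case (elim \<omega>)
    obtain b where b: "\<And>v. v \<in> variation_sums (\<lambda>t. M t \<omega>) t \<Longrightarrow> v \<le> b"
      using bv[OF elim(1)] by (auto simp: bdd_above_def)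
    obtain c :: nat where c: "b \<le> real c" using real_arch_simple by blast
    have "(\<Sum>j<Suc m. \<bar>\<Delta> m j \<omega>\<bar>) \<le> real c" for m
    proof -
      have "(\<Sum>j<Suc m. \<bar>\<Delta> m j \<omega>\<bar>) \<in> variation_sums (\<lambda>t. M t \<omega>) t"
        unfolding variation_sums_def \<Delta>_def using g_inc gin by blast
      then show ?thesis using b c by fastforce
    qed
    then have "\<omega> \<in> G c" using elim(1) by (simp add: G_def)
    then show ?case using elim(2) by auto
  qed
qed

text \<open>Stopping at the minimum of a localizing time and the hitting time of level
  \<open>n\<close> reduces the claim at a fixed time to a bounded martingale, without adding
  variation.\<close>

theorem cont_local_martingale_bv_null:
  assumes B: "cont_local_martingale P F B" and B0: "\<And>\<omega>. \<omega> \<in> space P \<Longrightarrow> B 0 \<omega> = 0"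
    and bv: "\<And>\<omega>. \<omega> \<in> space P \<Longrightarrow> locally_bv (\<lambda>t. B t \<omega>)"
  shows "AE \<omega> in P. \<forall>t\<ge>0. B t \<omega> = 0"
proof -
  have cont: "cont_paths P B" and ad: "adapted F B" using B by (auto simp: cont_local_martingale_iff)
  obtain \<tau> where \<tau>: "localizes B \<tau>" using B by (auto simp: cont_local_martingale_iff)
  have st: "stopping_time F (\<tau> n)" for n using \<tau> by (auto simp: localizes_def)
  have nn: "0 \<le> \<tau> n \<omega>" if "\<omega> \<in> space P" for n \<omega> using \<tau> that by (auto simp: localizes_def)
  have "AE \<omega> in P. B t \<omega> = 0" if t: "0 \<le> t" for t
  proof -
    have "AE \<omega> in P. B (min t (min (\<tau> n \<omega>) (hitting B (real n) t \<omega>))) \<omega> = 0" for n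
    proof -
      let ?S = "\<lambda>\<omega>. min (\<tau> n \<omega>) (hitting B (real n) t \<omega>)"
      let ?N = "\<lambda>s \<omega>. B (min s (?S \<omega>)) \<omega> - B 0 \<omega>"
      have hnn: "0 \<le> hitting B (real n) t \<omega>" if "\<omega> \<in> space P" for \<omega>
        using hitting_in[OF cont that t, of "real n"] t by auto
      have mart: "martingale P F ?N"
        by (rule localizes_stopped[OF cont \<tau> stopping_time_hitting[OF cont ad t] hnn])
      have contN: "cont_paths P ?N"
        using nn hnn by (intro cont_paths_stopped[OF cont]) auto
      have "AE \<omega> in P. ?N t \<omega> = 0"
      proof (rule bounded_bv_martingale_null[OF mart contN _ _ _ t])
        show "\<bar>?N s \<omega>\<bar> \<le> real n" if "0 \<le> s" "\<omega> \<in> space P" for s \<omega>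
          using bounded_until_hitting[OF cont that(2) t B0[OF that(2)], of "real n" "min s (?S \<omega>)"]
            B0[OF that(2)] nn[OF that(2)] hnn[OF that(2)] that(1) by auto
        show "?N 0 \<omega> = 0" if "\<omega> \<in> space P" for \<omega> using nn[OF that] hnn[OF that] by (simp add: min_absorb1)
        show "bdd_above (variation_sums (\<lambda>s. ?N s \<omega>) t)" if \<omega>: "\<omega> \<in> space P" for \<omega>
        proof (rule bdd_above_mono)
          show "bdd_above (variation_sums (\<lambda>s. B s \<omega>) t)" using bv[OF \<omega>] t by (auto simp: locally_bv_def)
          \<comment> \<open>Stopping the path amounts to stopping the partition: the points
            \<open>min (s i) (?S \<omega>)\<close> give the same sum for the original path.\<close>
          show "variation_sums (\<lambda>s. ?N s \<omega>) t \<subseteq> variation_sums (\<lambda>s. B s \<omega>) t"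
          proof
            fix v assume "v \<in> variation_sums (\<lambda>s. ?N s \<omega>) t"
            then obtain k s where s: "incseq s" "0 \<le> s 0" "s k \<le> t"
              "v = (\<Sum>i<k. \<bar>?N (s (Suc i)) \<omega> - ?N (s i) \<omega>\<bar>)" by (auto simp: variation_sums_def)
            have "incseq (\<lambda>i. min (s i) (?S \<omega>))" using s(1) unfolding incseq_def by (blast intro: min.mono order_refl)
            moreover have "0 \<le> min (s 0) (?S \<omega>)" using s nn[OF \<omega>] hnn[OF \<omega>] by auto
            moreover have "min (s k) (?S \<omega>) \<le> t" using s by auto
            ultimately show "v \<in> variation_sums (\<lambda>s. B s \<omega>) t"
              unfolding variation_sums_def using s(4) by (intro CollectI exI[of _ k] exI[of _ "\<lambda>i. min (s i) (?S \<omega>)"]) auto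
          qed
        qed
      qed
      with AE_space show ?thesis by eventually_elim (use B0 in auto)
    qed
    then have "AE \<omega> in P. \<forall>n. B (min t (min (\<tau> n \<omega>) (hitting B (real n) t \<omega>))) \<omega> = 0"
      by (simp add: AE_all_countable)
    moreover have "AE \<omega> in P. filterlim (\<lambda>n. \<tau> n \<omega>) at_top sequentially" using \<tau> by (auto simp: localizes_def)
    ultimately show ?thesis using AE_space
    proof eventually_elim
      case (elim \<omega>)
      \<comment> \<open>For large \<open>n\<close> nothing is stopped before \<open>t\<close>: the
        level exceeds the maximum of the path on \<open>[0,t]\<close>, so \<open>hitting\<close>
        takes its default value \<open>t\<close>.\<close>
      have "continuous_on {0..t} (\<lambda>s. \<bar>B s \<omega>\<bar>)"
        using cont elim(3) by (auto simp: cont_paths_def intro!: continuous_intros elim!: continuous_on_subset)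
      then obtain s where s: "\<forall>v\<in>{0..t}. \<bar>B v \<omega>\<bar> \<le> \<bar>B s \<omega>\<bar>"
        using continuous_attains_sup[of "{0..t}" "\<lambda>s. \<bar>B s \<omega>\<bar>"] t by auto
      have "\<forall>\<^sub>F n in sequentially. t \<le> \<tau> n \<omega>" using elim(2) unfolding filterlim_at_top by blast
      moreover have "\<forall>\<^sub>F n in sequentially. \<bar>B s \<omega>\<bar> < real n"
        using filterlim_real_sequentially unfolding filterlim_at_top_dense by blast
      ultimately have "\<forall>\<^sub>F n in sequentially. t \<le> \<tau> n \<omega> \<and> \<bar>B s \<omega>\<bar> < real n" by (rule eventually_conj)
      then obtain n where n: "t \<le> \<tau> n \<omega>" "\<bar>B s \<omega>\<bar> < real n" by (auto simp: eventually_sequentially)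
      have "hitting B (real n) t \<omega> = t"
        using hitting_in[OF cont elim(3) t, of "real n"] s n(2) by fastforce
      then have "min t (min (\<tau> n \<omega>) (hitting B (real n) t \<omega>)) = t" using n(1) by auto
      with elim(1) show ?case by metis
    qed
  qed
  \<comment> \<open>Countably many times share one null set; continuity then extends the equality to
    all times.\<close>
  then have "AE \<omega> in P. \<forall>q\<in>\<rat> \<inter> {0..}. B q \<omega> = 0"
    by (subst AE_ball_countable) (auto intro!: countable_Int1 countable_rat)
  with AE_space show ?thesis
  proof eventually_elim
    case (elim \<omega>)
    show ?case
    proof (intro allI impI, rule ccontr)
      fix t :: real assume t: "0 \<le> t" "B t \<omega> \<noteq> 0"
      have "continuous_on {0..} (\<lambda>s. B s \<omega>)" using cont elim(1) by (auto simp: cont_paths_def)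
      then obtain d where d: "d > 0" "\<And>s. s \<in> {0..} \<Longrightarrow> dist s t < d \<Longrightarrow> dist (B s \<omega>) (B t \<omega>) < \<bar>B t \<omega>\<bar>"
        using t unfolding continuous_on_iff by (metis atLeast_iff zero_less_abs_iff)
      obtain q where q: "q \<in> \<rat>" "t < q" "q < t + d" using Rats_dense_in_real[of t "t + d"] d(1) by auto
      then have "B q \<omega> = 0" using elim(2) t by auto
      then show False using d(2)[of q] q t by (auto simp: dist_real_def)
    qed
  qed
qed

end

section \<open>Stieltjes integrals against continuous paths\<close>

lemma sum_lessThan_add:
  fixes f :: "nat \<Rightarrow> real"
  shows "(\<Sum>i<m + k. f i) = (\<Sum>i<m. f i) + (\<Sum>i<k. f (m + i))"
  by (induction k) auto

lemma variation_sums_cong: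
  assumes "\<And>s. 0 \<le> s \<Longrightarrow> a s = b s"
  shows "variation_sums a t = variation_sums b t"
proof -
  have "(\<Sum>i<n. \<bar>a (s (Suc i)) - a (s i)\<bar>) = (\<Sum>i<n. \<bar>b (s (Suc i)) - b (s i)\<bar>)"
    if "incseq s" "0 \<le> s 0" for n and s :: "nat \<Rightarrow> real"
  proof -
    have "0 \<le> s i" for i using incseqD[OF that(1), of 0 i] that(2) by simp
    then show ?thesis using assms by simp
  qed
  then show ?thesis unfolding variation_sums_def by (intro Collect_cong ex_cong1) auto
qed

lemma locally_bv_cong: "(\<And>s. 0 \<le> s \<Longrightarrow> a s = b s) \<Longrightarrow> locally_bv a = locally_bv b"
  using variation_sums_cong[of a b] by (simp add: locally_bv_def)

text \<open>Processes are compared at nonnegative times only; both integrators clip their argument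
  at 0, so nothing else is seen.\<close>

lemma stieltjes_integral_cong:
  assumes "\<And>s. 0 \<le> s \<Longrightarrow> a s = b s"
  shows "stieltjes_integral f a t = stieltjes_integral f b t"
proof -
  have "variation a = variation b"
    using variation_sums_cong[of a b] assms by (simp add: variation_def fun_eq_iff)
  moreover have "a (max 0 s) = b (max 0 s)" for s using assms by simp
  ultimately show ?thesis by (simp add: stieltjes_integral_def)
qed

lemma locally_bv_lincomb:
  assumes "locally_bv a" "locally_bv b"
  shows "locally_bv (\<lambda>t. c * a t + d * b t)"
  unfolding locally_bv_def
proof (intro allI impI)
  fix t :: real assume t: "0 \<le> t"
  obtain A B where A: "\<And>v. v \<in> variation_sums a t \<Longrightarrow> v \<le> A" and B: "\<And>v. v \<in> variation_sums b t \<Longrightarrow> v \<le> B"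
    using assms t unfolding locally_bv_def bdd_above_def by metis
  show "bdd_above (variation_sums (\<lambda>t. c * a t + d * b t) t)"
  proof (rule bdd_aboveI)
    fix v assume "v \<in> variation_sums (\<lambda>t. c * a t + d * b t) t"
    then obtain n s where s: "incseq s" "0 \<le> s 0" "s n \<le> t"
      and v: "v = (\<Sum>i<n. \<bar>(c * a (s (Suc i)) + d * b (s (Suc i))) - (c * a (s i) + d * b (s i))\<bar>)"
      by (auto simp: variation_sums_def)
    have "v \<le> (\<Sum>i<n. \<bar>c\<bar> * \<bar>a (s (Suc i)) - a (s i)\<bar> + \<bar>d\<bar> * \<bar>b (s (Suc i)) - b (s i)\<bar>)"
      unfolding v
    proof (rule sum_mono)
      fix i
      have "(c * a (s (Suc i)) + d * b (s (Suc i))) - (c * a (s i) + d * b (s i))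
        = c * (a (s (Suc i)) - a (s i)) + d * (b (s (Suc i)) - b (s i))" by (simp add: algebra_simps)
      then show "\<bar>(c * a (s (Suc i)) + d * b (s (Suc i))) - (c * a (s i) + d * b (s i))\<bar>
        \<le> \<bar>c\<bar> * \<bar>a (s (Suc i)) - a (s i)\<bar> + \<bar>d\<bar> * \<bar>b (s (Suc i)) - b (s i)\<bar>"
        by (metis abs_mult abs_triangle_ineq)
    qed
    also have "\<dots> = \<bar>c\<bar> * (\<Sum>i<n. \<bar>a (s (Suc i)) - a (s i)\<bar>) + \<bar>d\<bar> * (\<Sum>i<n. \<bar>b (s (Suc i)) - b (s i)\<bar>)"
      by (simp add: sum.distrib sum_distrib_left)
    also have "\<dots> \<le> \<bar>c\<bar> * A + \<bar>d\<bar> * B"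
    proof (intro add_mono mult_left_mono A B)
      show "(\<Sum>i<n. \<bar>a (s (Suc i)) - a (s i)\<bar>) \<in> variation_sums a t"
        "(\<Sum>i<n. \<bar>b (s (Suc i)) - b (s i)\<bar>) \<in> variation_sums b t"
        unfolding variation_sums_def using s by blast+
    qed auto
    finally show "v \<le> \<bar>c\<bar> * A + \<bar>d\<bar> * B" .
  qed
qed

lemma variation_sums_zero: "0 \<le> t \<Longrightarrow> 0 \<in> variation_sums a t"
  unfolding variation_sums_def by (intro CollectI exI[of _ 0] exI[of _ "\<lambda>_. 0"]) (auto simp: incseq_def)

lemma variation_upper:
  "locally_bv a \<Longrightarrow> 0 \<le> t \<Longrightarrow> v \<in> variation_sums a t \<Longrightarrow> v \<le> variation a t"
  unfolding variation_def locally_bv_def by (auto intro: cSup_upper)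

text \<open>A partition up to \<open>u\<close> followed by one from \<open>u\<close> on is a
  partition of the whole interval. The increment joining the two is nonnegative in absolute value
  and is dropped.\<close>

lemma variation_append:
  assumes bv: "locally_bv a" and u: "0 \<le> u" and r: "incseq r" "u \<le> r 0" "r k \<le> T"
  shows "variation a u + (\<Sum>i<k. \<bar>a (r (Suc i)) - a (r i)\<bar>) \<le> variation a T"
proof -
  have T: "0 \<le> T" using u r incseqD[OF r(1), of 0 k] by simp
  have "v + (\<Sum>i<k. \<bar>a (r (Suc i)) - a (r i)\<bar>) \<le> variation a T" if "v \<in> variation_sums a u" for v
  proof -
    obtain n s where s: "incseq s" "0 \<le> s 0" "s n \<le> u" and v: "v = (\<Sum>i<n. \<bar>a (s (Suc i)) - a (s i)\<bar>)"
      using \<open>v \<in> variation_sums a u\<close> by (auto simp: variation_sums_def)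
    \<comment> \<open>The points \<open>s 0\<close> to \<open>s n\<close> keep their indices and
      \<open>r 0\<close> gets index \<open>Suc n\<close>; the step from \<open>n\<close> to
      \<open>Suc n\<close> is the joining increment, hence the length
      \<open>Suc n + k\<close>.\<close>
    define q where "q i = (if i \<le> n then s i else r (i - Suc n))" for i
    have "incseq q"
    proof (rule incseq_SucI)
      fix i
      consider "Suc i \<le> n" | "i = n" | "n < i" by linarith
      then show "q i \<le> q (Suc i)"
      proof cases
        case 3
        then have "Suc i - Suc n = Suc (i - Suc n)" by simp
        with 3 show ?thesis using r(1) by (simp add: q_def incseq_SucD del: diff_Suc_Suc)
      qed (use s r in \<open>auto simp: q_def incseq_SucD\<close>)
    qed
    moreover have "0 \<le> q 0" using s by (simp add: q_def)
    moreover have "q (Suc n + k) \<le> T" using r by (simp add: q_def)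
    ultimately have "(\<Sum>i<Suc n + k. \<bar>a (q (Suc i)) - a (q i)\<bar>) \<in> variation_sums a T"
      unfolding variation_sums_def by blast
    then have "(\<Sum>i<Suc n + k. \<bar>a (q (Suc i)) - a (q i)\<bar>) \<le> variation a T"
      by (rule variation_upper[OF bv T])
    moreover have "(\<Sum>i<Suc n + k. \<bar>a (q (Suc i)) - a (q i)\<bar>)
      = v + \<bar>a (r 0) - a (s n)\<bar> + (\<Sum>i<k. \<bar>a (r (Suc i)) - a (r i)\<bar>)"
      unfolding sum_lessThan_add v by (simp add: q_def)
    ultimately show ?thesis by linarith
  qed
  then have "v \<le> variation a T - (\<Sum>i<k. \<bar>a (r (Suc i)) - a (r i)\<bar>)" if "v \<in> variation_sums a u" for v
    using that by fastforce
  then have "Sup (variation_sums a u) \<le> variation a T - (\<Sum>i<k. \<bar>a (r (Suc i)) - a (r i)\<bar>)"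
    using variation_sums_zero[OF u] by (intro cSup_least) auto
  then show ?thesis using u by (simp add: variation_def)
qed

lemma variation_max: "variation a (max 0 x) = variation a x"
  by (simp add: variation_def)

text \<open>The one-step case of \<open>variation_append\<close>. It makes both integrators of
  \<open>stieltjes_integral\<close>, the variation and its difference with the path,
  nondecreasing.\<close>

lemma variation_increment:
  assumes "locally_bv a" "x \<le> y"
  shows "\<bar>a (max 0 y) - a (max 0 x)\<bar> \<le> variation a y - variation a x"
proof -
  let ?r = "\<lambda>i::nat. if i = 0 then max 0 x else max 0 y"
  have "incseq ?r" using assms(2) by (intro incseq_SucI) auto
  from variation_append[OF assms(1) _ this, of "max 0 x" 1 "max 0 y"]
  show ?thesis by (simp add: variation_max)
qed

lemma variation_mono: "locally_bv a \<Longrightarrow> x \<le> y \<Longrightarrow> variation a x \<le> variation a y"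
  using variation_increment[of a x y] by linarith

text \<open>Cut a nearly optimal partition of \<open>[0, t + 1]\<close> at \<open>t\<close> and \<open>u > t\<close>. Its part inside \<open>[t, u]\<close> has a number
  of increments not depending on \<open>u\<close>, so it contributes arbitrarily little as \<open>u\<close> decreases to \<open>t\<close>.\<close>

lemma variation_right_continuous:
  assumes bv: "locally_bv a" and cont: "continuous_on {0..} a"
  shows "continuous (at_right t) (variation a)"
proof (cases "0 \<le> t")
  case False
  have "\<forall>\<^sub>F x in at_right t. variation a t = variation a x"
    using eventually_at_right_real[of t 0] False
    by (auto simp: variation_def max_def elim!: eventually_mono)
  then have "(variation a \<longlongrightarrow> variation a t) (at_right t)"
    by (rule Lim_transform_eventually[OF tendsto_const])
  then show ?thesis by (simp add: continuous_within)
next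
  case t: True
  have "\<forall>\<^sub>F u in at_right t. dist (variation a u) (variation a t) < e" if e: "0 < e" for e
  proof -
    define T where "T = t + 1"
    have "variation a T = Sup (variation_sums a T)" using t by (simp add: variation_def T_def)
    then have "\<exists>v\<in>variation_sums a T. variation a T - e / 2 < v"
      using variation_sums_zero[of T a] bv t e
      by (subst less_cSup_iff[symmetric]) (auto simp: locally_bv_def T_def)
    then obtain n s where s: "incseq s" "0 \<le> s 0" "s n \<le> T"
      and big: "variation a T - e / 2 < (\<Sum>i<n. \<bar>a (s (Suc i)) - a (s i)\<bar>)"
      by (auto simp: variation_sums_def)
    \<comment> \<open>The clamp of \<open>x\<close> to \<open>[t,u]\<close>. Each increment of the
      path is then the sum of its moves before \<open>t\<close>, within \<open>[t,u]\<close> and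
      after \<open>u\<close>.\<close>
    define c where "c u x = min (max x t) u" for u x :: real
    have "((\<lambda>u. a (c u x)) \<longlongrightarrow> a t) (at_right t)" for x
    proof (rule continuous_on_tendsto_compose[OF cont])
      have "((\<lambda>u. c u x) \<longlongrightarrow> min (max x t) t) (at_right t)"
        unfolding c_def by (intro tendsto_min tendsto_const tendsto_ident_at)
      then show "((\<lambda>u. c u x) \<longlongrightarrow> t) (at_right t)" by (simp add: min_absorb2)
      show "\<forall>\<^sub>F u in at_right t. c u x \<in> {0..}"
        using eventually_at_right_less[of t] by eventually_elim (use t in \<open>auto simp: c_def\<close>)
    qed (use t in auto)
    then have "((\<lambda>u. \<Sum>i<n. \<bar>a (c u (s (Suc i))) - a (c u (s i))\<bar>) \<longlongrightarrow> (\<Sum>i<n. \<bar>a t - a t\<bar>)) (at_right t)"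
      by (intro tendsto_sum tendsto_rabs tendsto_diff)
    then have "\<forall>\<^sub>F u in at_right t. (\<Sum>i<n. \<bar>a (c u (s (Suc i))) - a (c u (s i))\<bar>) < e / 2"
      using e by (intro order_tendstoD(2)) auto
    moreover have "\<forall>\<^sub>F u in at_right t. u \<in> {t<..<T}"
      by (rule eventually_at_right_real) (simp add: T_def)
    ultimately show ?thesis
    proof eventually_elim
      case (elim u)
      then have u: "t < u" "u < T" by auto
      have split: "a x = a (min x t) + (a (c u x) - a t) + (a (max x u) - a u)" for x
        using u by (auto simp: c_def min_def max_def)
      have "(\<Sum>i<n. \<bar>a (s (Suc i)) - a (s i)\<bar>)
        \<le> (\<Sum>i<n. \<bar>a (min (s (Suc i)) t) - a (min (s i) t)\<bar> + \<bar>a (c u (s (Suc i))) - a (c u (s i))\<bar>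
          + \<bar>a (max (s (Suc i)) u) - a (max (s i) u)\<bar>)"
      proof (rule sum_mono)
        fix i
        show "\<bar>a (s (Suc i)) - a (s i)\<bar> \<le> \<bar>a (min (s (Suc i)) t) - a (min (s i) t)\<bar> + \<bar>a (c u (s (Suc i))) - a (c u (s i))\<bar>
          + \<bar>a (max (s (Suc i)) u) - a (max (s i) u)\<bar>"
          using split[of "s (Suc i)"] split[of "s i"] by linarith
      qed
      also have "\<dots> = (\<Sum>i<n. \<bar>a (min (s (Suc i)) t) - a (min (s i) t)\<bar>)
        + (\<Sum>i<n. \<bar>a (c u (s (Suc i))) - a (c u (s i))\<bar>)
        + (\<Sum>i<n. \<bar>a (max (s (Suc i)) u) - a (max (s i) u)\<bar>)"
        by (simp add: sum.distrib)
      finally have 1: "(\<Sum>i<n. \<bar>a (s (Suc i)) - a (s i)\<bar>)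
        \<le> (\<Sum>i<n. \<bar>a (min (s (Suc i)) t) - a (min (s i) t)\<bar>)
        + (\<Sum>i<n. \<bar>a (c u (s (Suc i))) - a (c u (s i))\<bar>)
        + (\<Sum>i<n. \<bar>a (max (s (Suc i)) u) - a (max (s i) u)\<bar>)" .
      have "(\<Sum>i<n. \<bar>a (min (s (Suc i)) t) - a (min (s i) t)\<bar>) \<in> variation_sums a t"
        unfolding variation_sums_def using s t
        by (intro CollectI exI[of _ n] exI[of _ "\<lambda>i. min (s i) t"]) (auto simp: incseq_def min_le_iff_disj)
      then have 2: "(\<Sum>i<n. \<bar>a (min (s (Suc i)) t) - a (min (s i) t)\<bar>) \<le> variation a t"
        by (rule variation_upper[OF bv t])
      have 3: "variation a u + (\<Sum>i<n. \<bar>a (max (s (Suc i)) u) - a (max (s i) u)\<bar>) \<le> variation a T"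
      proof (rule variation_append[OF bv])
        show "incseq (\<lambda>i. max (s i) u)" using s(1) unfolding incseq_def by (blast intro: max.mono order_refl)
      qed (use s u t in auto)
      have "variation a t \<le> variation a u" using variation_mono[OF bv] u by simp
      \<comment> \<open>With \<open>V = variation a\<close> this reads
        \<open>V T - e / 2 < V t + e / 2 + (V T - V u)\<close>, that is,
        \<open>V u - V t < e\<close>.\<close>
      then show ?case using 1 2 3 big elim(1) by (simp add: dist_real_def)
    qed
  qed
  then have "(variation a \<longlongrightarrow> variation a t) (at_right t)" by (rule tendstoI)
  then show ?thesis by (simp add: continuous_within)
qed

lemma clipped_right_continuous:
  assumes "continuous_on {0..} a"
  shows "continuous (at_right t) (\<lambda>s. a (max 0 s :: real) :: real)"
proof -
  have "continuous_on UNIV (\<lambda>s. a (max 0 s))"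
    by (rule continuous_on_compose2[OF assms]) (auto intro!: continuous_intros)
  then have "isCont (\<lambda>s. a (max 0 s)) t" by (simp add: continuous_on_eq_continuous_at)
  then show ?thesis by (rule continuous_at_imp_continuous_within)
qed

section \<open>Bounded integrands\<close>

text \<open>A class of integrands stable under affine maps and squares, which suits both the
  integrability of \<open>V\<close> and that of its square. It restricts only nonnegative times,
  since progressivity says nothing about others.\<close>

definition bounded_path :: "(real \<Rightarrow> real) \<Rightarrow> bool" where
  "bounded_path f \<longleftrightarrow> (\<exists>K. \<forall>s\<ge>0. \<bar>f s\<bar> \<le> K) \<and> (\<forall>t\<ge>0. set_borel_measurable borel {0<..t} f)"

lemma bounded_path_set_integrable:
  assumes f: "bounded_path f" and t: "0 \<le> t"
    and F: "\<And>x y. x \<le> y \<Longrightarrow> F x \<le> F y" "\<And>x. continuous (at_right x) F"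
  shows "set_integrable (interval_measure F) {0<..t} f"
proof -
  obtain K where K: "\<And>s. 0 \<le> s \<Longrightarrow> \<bar>f s\<bar> \<le> K" using f by (auto simp: bounded_path_def)
  have m: "(\<lambda>s. indicator {0<..t} s *\<^sub>R f s) \<in> borel_measurable borel"
    using f t by (auto simp: bounded_path_def set_borel_measurable_def)
  show ?thesis unfolding set_integrable_def
  proof (rule integrableI_bounded_set[where A="{0<..t}" and B=K])
    show "(\<lambda>s. indicator {0<..t} s *\<^sub>R f s) \<in> borel_measurable (interval_measure F)"
      using m by (simp cong: measurable_cong_sets)
    show "emeasure (interval_measure F) {0<..t} < \<infinity>"
      using emeasure_interval_measure_Ioc[OF t F] by simp
    show "AE x in interval_measure F. x \<in> {0<..t} \<longrightarrow> norm (indicator {0<..t} x *\<^sub>R f x) \<le> K"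
      using K by (intro AE_I2) auto
  qed auto
qed

lemma bounded_path_affine:
  assumes "bounded_path f"
  shows "bounded_path (\<lambda>s. \<alpha> + \<beta> * f s)"
proof -
  obtain K where K: "\<And>s. 0 \<le> s \<Longrightarrow> \<bar>f s\<bar> \<le> K" using assms by (auto simp: bounded_path_def)
  have "\<bar>\<alpha> + \<beta> * f s\<bar> \<le> \<bar>\<alpha>\<bar> + \<bar>\<beta>\<bar> * K" if "0 \<le> s" for s
    using K[OF that] abs_triangle_ineq[of \<alpha> "\<beta> * f s"] mult_left_mono[of "\<bar>f s\<bar>" K "\<bar>\<beta>\<bar>"] by (simp add: abs_mult)
  moreover have "set_borel_measurable borel {0<..t} (\<lambda>s. \<alpha> + \<beta> * f s)" if "0 \<le> t" for t
  proof -
    have m: "(\<lambda>s. indicator {0<..t} s *\<^sub>R f s) \<in> borel_measurable borel"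
      using assms that by (auto simp: bounded_path_def set_borel_measurable_def)
    have "(\<lambda>s. indicator {0<..t} s * \<alpha> + \<beta> * (indicator {0<..t} s *\<^sub>R f s)) \<in> borel_measurable borel"
      using m by measurable
    then show ?thesis by (simp add: set_borel_measurable_def algebra_simps)
  qed
  ultimately show ?thesis unfolding bounded_path_def by blast
qed

lemma bounded_path_square:
  assumes "bounded_path f"
  shows "bounded_path (\<lambda>s. (f s)\<^sup>2)"
proof -
  obtain K where K: "\<And>s. 0 \<le> s \<Longrightarrow> \<bar>f s\<bar> \<le> K" using assms by (auto simp: bounded_path_def)
  have "\<bar>(f s)\<^sup>2\<bar> \<le> K\<^sup>2" if "0 \<le> s" for s
    using power_mono[OF K[OF that] abs_ge_zero, of 2] by simp
  moreover have "set_borel_measurable borel {0<..t} (\<lambda>s. (f s)\<^sup>2)" if "0 \<le> t" for t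
  proof -
    have m: "(\<lambda>s. indicator {0<..t} s *\<^sub>R f s) \<in> borel_measurable borel"
      using assms that by (auto simp: bounded_path_def set_borel_measurable_def)
    have "(\<lambda>s. (indicator {0<..t} s *\<^sub>R f s)\<^sup>2) \<in> borel_measurable borel"
      using m by measurable
    moreover have "(indicator {0<..t} s *\<^sub>R f s)\<^sup>2 = indicator {0<..t} s *\<^sub>R (f s)\<^sup>2" for s
      by (auto simp: indicator_def)
    ultimately show ?thesis by (simp add: set_borel_measurable_def)
  qed
  ultimately show ?thesis unfolding bounded_path_def by blast
qed

context
  fixes a :: "real \<Rightarrow> real"
  assumes bv: "locally_bv a" and cont: "continuous_on {0..} a"
begin

lemma complement_mono: "x \<le> y \<Longrightarrow> variation a x - a (max 0 x) \<le> variation a y - a (max 0 y)"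
  using variation_increment[OF bv, of x y] by linarith

lemma complement_right_continuous: "continuous (at_right x) (\<lambda>s. variation a s - a (max 0 s))"
  by (intro continuous_diff variation_right_continuous[OF bv cont] clipped_right_continuous[OF cont])

lemma bounded_path_stieltjes_integrable: "bounded_path f \<Longrightarrow> stieltjes_integrable f a"
  unfolding stieltjes_integrable_def
  using bounded_path_set_integrable variation_mono[OF bv] variation_right_continuous[OF bv cont] by blast

text \<open>The identity holds for each of the two nondecreasing integrators. A constant yields
  \<alpha> times their increments, whose difference is the increment of \<open>a\<close>, as the
  variations cancel.\<close>

lemma stieltjes_integral_affine:
  assumes f: "bounded_path f" and t: "0 \<le> t"
  shows "stieltjes_integral (\<lambda>s. \<alpha> + \<beta> * f s) a t = \<alpha> * (a t - a 0) + \<beta> * stieltjes_integral f a t"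
proof -
  have aff: "(LINT s:{0<..t}|interval_measure G. \<alpha> + \<beta> * f s)
      = \<alpha> * (G t - G 0) + \<beta> * (LINT s:{0<..t}|interval_measure G. f s)"
    if G: "\<And>x y. x \<le> y \<Longrightarrow> G x \<le> G y" "\<And>x. continuous (at_right x) G" for G
  proof -
    have c: "set_integrable (interval_measure G) {0<..t} (\<lambda>s. \<alpha>)"
      using bounded_path_affine[OF f, of \<alpha> 0] bounded_path_set_integrable[OF _ t G] by simp
    have i: "set_integrable (interval_measure G) {0<..t} (\<lambda>s. \<beta> * f s)"
      using bounded_path_set_integrable[OF f t G] by simp
    have "(LINT s:{0<..t}|interval_measure G. \<alpha>) = \<alpha> * (G t - G 0)"
      using measure_interval_measure_Ioc[OF t G] by (simp add: set_lebesgue_integral_def)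
    then show ?thesis using set_integral_add(2)[OF c i] by simp
  qed
  show ?thesis
    using aff[of "variation a", OF variation_mono[OF bv] variation_right_continuous[OF bv cont]]
      aff[of "\<lambda>s. variation a s - a (max 0 s)", OF complement_mono complement_right_continuous] t
    by (simp add: stieltjes_integral_def algebra_simps)
qed

end

section \<open>Stochastic integrals\<close>

context filtered_prob_space
begin

section \<open>Affine functions of the integrand\<close>

lemma progressive_bounded_path:
  assumes V: "progressive F V" and K: "\<And>s \<omega>. \<bar>V s \<omega>\<bar> \<le> K" and \<omega>: "\<omega> \<in> space P"
  shows "bounded_path (\<lambda>s. V s \<omega>)"
  unfolding bounded_path_def
proof (intro conjI allI impI)
  show "\<exists>K. \<forall>s\<ge>0. \<bar>V s \<omega>\<bar> \<le> K" using K by blast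
  fix t :: real assume t: "0 \<le> t"
  have "(\<lambda>(s, \<omega>). V s \<omega>) \<in> borel_measurable (restrict_space borel {0..t} \<Otimes>\<^sub>M F t)"
    using V t by (auto simp: progressive_def)
  from measurable_Pair1[OF this, of \<omega>] \<omega>
  have "(\<lambda>s. V s \<omega>) \<in> borel_measurable (restrict_space borel {0..t})" by (simp add: space_F)
  then have "(\<lambda>s. indicator {0..t} s *\<^sub>R V s \<omega>) \<in> borel_measurable borel"
    by (subst (asm) borel_measurable_restrict_space_iff) auto
  then have "(\<lambda>s. indicator {0<..t} s *\<^sub>R (indicator {0..t} s *\<^sub>R V s \<omega>)) \<in> borel_measurable borel"
    by measurable
  moreover have "indicator {0<..t} s *\<^sub>R (indicator {0..t} s *\<^sub>R V s \<omega>) = indicator {0<..t} s *\<^sub>R V s \<omega>" for s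
    by (auto simp: indicator_def)
  ultimately show "set_borel_measurable borel {0<..t} (\<lambda>s. V s \<omega>)"
    by (simp only: set_borel_measurable_def)
qed

lemma progressive_affine:
  assumes "progressive F V"
  shows "progressive F (\<lambda>s \<omega>. \<alpha> + \<beta> * V s \<omega>)"
  unfolding progressive_def
proof (intro allI impI)
  fix t :: real assume "0 \<le> t"
  then have [measurable]: "(\<lambda>(s, \<omega>). V s \<omega>) \<in> borel_measurable (restrict_space borel {0..t} \<Otimes>\<^sub>M F t)"
    using assms by (auto simp: progressive_def)
  have "(\<lambda>p. \<alpha> + \<beta> * (case p of (s, \<omega>) \<Rightarrow> V s \<omega>)) \<in> borel_measurable (restrict_space borel {0..t} \<Otimes>\<^sub>M F t)"
    by measurable
  then show "(\<lambda>(s, \<omega>). \<alpha> + \<beta> * V s \<omega>) \<in> borel_measurable (restrict_space borel {0..t} \<Otimes>\<^sub>M F t)"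
    by (simp add: case_prod_beta')
qed

lemma cont_bv_process_lincomb:
  "cont_bv_process P F A \<Longrightarrow> cont_bv_process P F B \<Longrightarrow> cont_bv_process P F (\<lambda>t \<omega>. a * A t \<omega> + b * B t \<omega>)"
  by (auto simp: cont_bv_process_def intro!: adapted_lincomb cont_paths_lincomb locally_bv_lincomb)

lemma cont_bv_processD:
  assumes "cont_bv_process P F A" "\<omega> \<in> space P"
  shows "locally_bv (\<lambda>t. A t \<omega>)" "continuous_on {0..} (\<lambda>t. A t \<omega>)" "A 0 \<omega> = 0"
  using assms by (auto simp: cont_bv_process_def cont_paths_def)

lemma cont_local_martingale_minus_initial:
  assumes M: "cont_local_martingale P F M"
  shows "cont_local_martingale P F (\<lambda>t \<omega>. M t \<omega> - M 0 \<omega>)"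
proof -
  obtain \<tau> where \<tau>: "localizes M \<tau>" using M by (auto simp: cont_local_martingale_iff)
  then have "localizes (\<lambda>t \<omega>. M t \<omega> - M 0 \<omega>) \<tau>" by (simp add: localizes_def)
  moreover have "adapted F (\<lambda>t \<omega>. M t \<omega> - M 0 \<omega>)"
    unfolding adapted_def
  proof (intro allI impI borel_measurable_diff)
    fix t :: real assume t: "0 \<le> t"
    have ad: "adapted F M" using M by (simp add: cont_local_martingale_iff)
    show "M t \<in> borel_measurable (F t)" using ad t by (simp add: adapted_def)
    show "M 0 \<in> borel_measurable (F t)"
      by (rule measurable_F_mono[OF t]) (use ad in \<open>simp add: adapted_def\<close>)
  qed
  moreover have "cont_paths P (\<lambda>t \<omega>. M t \<omega> - M 0 \<omega>)"
    using M by (auto simp: cont_local_martingale_iff cont_paths_def intro!: continuous_intros)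
  ultimately show ?thesis unfolding cont_local_martingale_iff by auto
qed

text \<open>The candidate is verified against every \<open>N\<close> with the given bracket
  \<open>C\<close> of \<open>M\<close> and \<open>N\<close>: a constant integrand turns
  \<open>C\<close> into \<open>\<alpha> * C\<close>, because \<open>C\<close> starts at 0.
  Boundedness of the new integrand gives its square integrability.\<close>

lemma has_local_martingale_integral_affine:
  assumes Z: "has_local_martingale_integral P F V M Z" and M: "cont_local_martingale P F M"
    and K: "\<And>s \<omega>. \<bar>V s \<omega>\<bar> \<le> K"
  shows "has_local_martingale_integral P F (\<lambda>s \<omega>. \<alpha> + \<beta> * V s \<omega>) M (\<lambda>t \<omega>. \<alpha> * (M t \<omega> - M 0 \<omega>) + \<beta> * Z t \<omega>)"
  unfolding has_local_martingale_integral_def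
proof (intro conjI allI impI)
  have V: "progressive F V" and Zm: "cont_local_martingale P F Z"
    using Z by (auto simp: has_local_martingale_integral_def)
  have path: "bounded_path (\<lambda>s. V s \<omega>)" if "\<omega> \<in> space P" for \<omega>
    by (rule progressive_bounded_path[OF V K that])
  show "progressive F (\<lambda>s \<omega>. \<alpha> + \<beta> * V s \<omega>)" by (rule progressive_affine[OF V])
  obtain Q where Q: "has_covariation P F M M Q"
    using Z by (auto simp: has_local_martingale_integral_def)
  have "AE \<omega> in P. stieltjes_integrable (\<lambda>s. (\<alpha> + \<beta> * V s \<omega>)\<^sup>2) (\<lambda>s. Q s \<omega>)"
    using Q by (intro AE_I2 bounded_path_stieltjes_integrable bounded_path_square bounded_path_affine path cont_bv_processD)
      (auto simp: has_covariation_def)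
  then show "\<exists>Q. has_covariation P F M M Q \<and>
      (AE \<omega> in P. stieltjes_integrable (\<lambda>s. (\<alpha> + \<beta> * V s \<omega>)\<^sup>2) (\<lambda>s. Q s \<omega>))" using Q by blast
  show Z': "cont_local_martingale P F (\<lambda>t \<omega>. \<alpha> * (M t \<omega> - M 0 \<omega>) + \<beta> * Z t \<omega>)"
    by (rule cont_local_martingale_lincomb[OF cont_local_martingale_minus_initial[OF M] Zm])
  show "\<forall>\<omega>\<in>space P. \<alpha> * (M 0 \<omega> - M 0 \<omega>) + \<beta> * Z 0 \<omega> = 0"
    using Z by (auto simp: has_local_martingale_integral_def)
  fix N assume N: "cont_local_martingale P F N"
  then obtain C D where C: "has_covariation P F M N C" and D: "has_covariation P F Z N D"
    and ae: "AE \<omega> in P. \<forall>t\<ge>0. D t \<omega> = stieltjes_integral (\<lambda>s. V s \<omega>) (\<lambda>s. C s \<omega>) t"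
    using Z by (auto simp: has_local_martingale_integral_def)
  let ?D = "\<lambda>t \<omega>. \<alpha> * C t \<omega> + \<beta> * D t \<omega>"
  have "has_covariation P F (\<lambda>t \<omega>. \<alpha> * (M t \<omega> - M 0 \<omega>) + \<beta> * Z t \<omega>) N ?D"
    unfolding has_covariation_def
  proof
    show "cont_bv_process P F ?D" using C D by (intro cont_bv_process_lincomb) (auto simp: has_covariation_def)
    have 1: "cont_local_martingale P F (\<lambda>t \<omega>. \<alpha> * (M t \<omega> * N t \<omega> - C t \<omega>) + \<beta> * (Z t \<omega> * N t \<omega> - D t \<omega>))"
      using C D by (intro cont_local_martingale_lincomb) (auto simp: has_covariation_def)
    \<comment> \<open>Centring \<open>M\<close> leaves the product \<open>M 0 * N\<close> over,
      which is itself a local martingale because \<open>M 0\<close> is known at time 0.\<close>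
    have "M 0 \<in> borel_measurable (F 0)" using M by (simp add: cont_local_martingale_iff adapted_def)
    then have 2: "cont_local_martingale P F (\<lambda>t \<omega>. M 0 \<omega> * N t \<omega>)"
      by (rule cont_local_martingale_initial_mult[OF N])
    have "(\<lambda>t \<omega>. (\<alpha> * (M t \<omega> - M 0 \<omega>) + \<beta> * Z t \<omega>) * N t \<omega> - (\<alpha> * C t \<omega> + \<beta> * D t \<omega>))
      = (\<lambda>t \<omega>. 1 * (\<alpha> * (M t \<omega> * N t \<omega> - C t \<omega>) + \<beta> * (Z t \<omega> * N t \<omega> - D t \<omega>)) + (- \<alpha>) * (M 0 \<omega> * N t \<omega>))"
      by (simp add: fun_eq_iff algebra_simps)
    then show "cont_local_martingale P F (\<lambda>t \<omega>. (\<alpha> * (M t \<omega> - M 0 \<omega>) + \<beta> * Z t \<omega>) * N t \<omega> - ?D t \<omega>)"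
      using cont_local_martingale_lincomb[OF 1 2, of 1 "- \<alpha>"] by simp
  qed
  moreover have "AE \<omega> in P. \<forall>t\<ge>0. ?D t \<omega> = stieltjes_integral (\<lambda>s. \<alpha> + \<beta> * V s \<omega>) (\<lambda>s. C s \<omega>) t"
    using ae AE_space
  proof eventually_elim
    case (elim \<omega>)
    have Cbv: "cont_bv_process P F C" using C by (simp add: has_covariation_def)
    show ?case
      using elim(1) cont_bv_processD(3)[OF Cbv elim(2)]
        stieltjes_integral_affine[OF cont_bv_processD(1,2)[OF Cbv elim(2)] path[OF elim(2)]] by simp
  qed
  ultimately show "\<exists>C D. has_covariation P F M N C \<and>
      has_covariation P F (\<lambda>t \<omega>. \<alpha> * (M t \<omega> - M 0 \<omega>) + \<beta> * Z t \<omega>) N D \<and>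
      (AE \<omega> in P. \<forall>t\<ge>0. D t \<omega> = stieltjes_integral (\<lambda>s. \<alpha> + \<beta> * V s \<omega>) (\<lambda>s. C s \<omega>) t)"
    using C by blast
qed

section \<open>Uniqueness of decompositions, covariations and integrals\<close>

lemma cont_local_martingale_diff:
  assumes "cont_local_martingale P F M" "cont_local_martingale P F N"
  shows "cont_local_martingale P F (\<lambda>t \<omega>. M t \<omega> - N t \<omega>)"
  using cont_local_martingale_lincomb[OF assms, of 1 "- 1"] by simp

text \<open>The difference \<open>M - M'\<close> equals \<open>A' - A\<close> and so has locally
  bounded variation. The normalization of \<open>A\<close> and \<open>A'\<close> at time 0 makes it
  start at 0, so it vanishes instead of being merely constant.\<close>

lemma semimartingale_decomp_unique:
  assumes 1: "semimartingale_decomp P F X M A" and 2: "semimartingale_decomp P F X M' A'"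
  shows "AE \<omega> in P. \<forall>t\<ge>0. M t \<omega> = M' t \<omega> \<and> A t \<omega> = A' t \<omega>"
proof -
  have A: "cont_bv_process P F A" "cont_bv_process P F A'"
    and M: "cont_local_martingale P F M" "cont_local_martingale P F M'"
    using 1 2 by (auto simp: semimartingale_decomp_def)
  have eq: "M t \<omega> - M' t \<omega> = (- 1) * A t \<omega> + 1 * A' t \<omega>" if "0 \<le> t" "\<omega> \<in> space P" for t \<omega>
  proof -
    have "X t \<omega> = M t \<omega> + A t \<omega>" "X t \<omega> = M' t \<omega> + A' t \<omega>"
      using 1 2 that unfolding semimartingale_decomp_def by blast+
    then show ?thesis by simp
  qed
  have "AE \<omega> in P. \<forall>t\<ge>0. M t \<omega> - M' t \<omega> = 0"
  proof (rule cont_local_martingale_bv_null[OF cont_local_martingale_diff[OF M]])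
    show "M 0 \<omega> - M' 0 \<omega> = 0" if "\<omega> \<in> space P" for \<omega>
      using eq[OF _ that, of 0] cont_bv_processD(3)[OF A(1) that] cont_bv_processD(3)[OF A(2) that] by simp
    show "locally_bv (\<lambda>t. M t \<omega> - M' t \<omega>)" if "\<omega> \<in> space P" for \<omega>
    proof -
      have "locally_bv (\<lambda>t. (- 1) * A t \<omega> + 1 * A' t \<omega>)"
        by (intro locally_bv_lincomb cont_bv_processD(1)[OF _ that] A)
      then show ?thesis
        using locally_bv_cong[of "\<lambda>t. M t \<omega> - M' t \<omega>" "\<lambda>t. (- 1) * A t \<omega> + 1 * A' t \<omega>"] eq[OF _ that]
        by blast
    qed
  qed
  with AE_space show ?thesis by eventually_elim (use eq in force)
qed

text \<open>Two local martingales that agree only almost surely are allowed, because two versions of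
  an integral may come with different decompositions. The product \<open>(M - M') * N\<close> is a
  null process, and with it \<open>C - C'\<close> is a combination of local martingales.\<close>

lemma covariation_unique:
  assumes C: "has_covariation P F M N C" and C': "has_covariation P F M' N C'"
    and M: "cont_local_martingale P F M" "cont_local_martingale P F M'" and N: "cont_local_martingale P F N"
    and eq: "AE \<omega> in P. \<forall>t\<ge>0. M t \<omega> = M' t \<omega>"
  shows "AE \<omega> in P. \<forall>t\<ge>0. C t \<omega> = C' t \<omega>"
proof -
  have bv: "cont_bv_process P F C" "cont_bv_process P F C'"
    and lm: "cont_local_martingale P F (\<lambda>t \<omega>. M t \<omega> * N t \<omega> - C t \<omega>)"
      "cont_local_martingale P F (\<lambda>t \<omega>. M' t \<omega> * N t \<omega> - C' t \<omega>)"
    using C C' by (auto simp: has_covariation_def)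
  have null: "cont_local_martingale P F (\<lambda>t \<omega>. (M t \<omega> - M' t \<omega>) * N t \<omega>)"
  proof (rule cont_local_martingale_null)
    have D: "cont_local_martingale P F (\<lambda>t \<omega>. M t \<omega> - M' t \<omega>)" by (rule cont_local_martingale_diff[OF M])
    show "adapted F (\<lambda>t \<omega>. (M t \<omega> - M' t \<omega>) * N t \<omega>)" "cont_paths P (\<lambda>t \<omega>. (M t \<omega> - M' t \<omega>) * N t \<omega>)"
      using D N by (auto simp: cont_local_martingale_iff intro!: adapted_mult cont_paths_mult)
    show "AE \<omega> in P. \<forall>t\<ge>0. (M t \<omega> - M' t \<omega>) * N t \<omega> = 0" using eq by eventually_elim auto
  qed
  have "(\<lambda>t \<omega>. C t \<omega> - C' t \<omega>)
    = (\<lambda>t \<omega>. (M t \<omega> - M' t \<omega>) * N t \<omega> - ((M t \<omega> * N t \<omega> - C t \<omega>) - (M' t \<omega> * N t \<omega> - C' t \<omega>)))"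
    by (simp add: fun_eq_iff algebra_simps)
  then have "cont_local_martingale P F (\<lambda>t \<omega>. C t \<omega> - C' t \<omega>)"
    using cont_local_martingale_diff[OF null cont_local_martingale_diff[OF lm]] by simp
  then have "AE \<omega> in P. \<forall>t\<ge>0. C t \<omega> - C' t \<omega> = 0"
  proof (rule cont_local_martingale_bv_null)
    show "C 0 \<omega> - C' 0 \<omega> = 0" if "\<omega> \<in> space P" for \<omega>
      using cont_bv_processD(3)[OF bv(1) that] cont_bv_processD(3)[OF bv(2) that] by simp
    show "locally_bv (\<lambda>t. C t \<omega> - C' t \<omega>)" if "\<omega> \<in> space P" for \<omega>
      using locally_bv_lincomb[OF cont_bv_processD(1)[OF bv(1) that] cont_bv_processD(1)[OF bv(2) that], of 1 "- 1"] by simp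
  qed
  then show ?thesis by eventually_elim auto
qed

text \<open>With \<open>W = Z - Z'\<close>, the process \<open>D - D'\<close> is a covariation of
  \<open>W\<close> with itself. It vanishes because \<open>D\<close> and \<open>D'\<close> integrate
  the same \<open>V\<close> against almost surely equal paths \<open>C\<close> and
  \<open>C'\<close>.\<close>

lemma local_martingale_integral_unique:
  assumes Z: "has_local_martingale_integral P F V M Z" and Z': "has_local_martingale_integral P F V M' Z'"
    and M: "cont_local_martingale P F M" "cont_local_martingale P F M'"
    and eq: "AE \<omega> in P. \<forall>t\<ge>0. M t \<omega> = M' t \<omega>" and t: "0 \<le> t"
  shows "AE \<omega> in P. Z t \<omega> = Z' t \<omega>"
proof -
  define W where "W t \<omega> = Z t \<omega> - Z' t \<omega>" for t \<omega>
  have Zm: "cont_local_martingale P F Z" "cont_local_martingale P F Z'"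
    using Z Z' by (auto simp: has_local_martingale_integral_def)
  have W: "cont_local_martingale P F W"
    using cont_local_martingale_diff[OF Zm] by (simp add: W_def[abs_def])
  obtain C D where C: "has_covariation P F M W C" and D: "has_covariation P F Z W D"
    and ae: "AE \<omega> in P. \<forall>t\<ge>0. D t \<omega> = stieltjes_integral (\<lambda>s. V s \<omega>) (\<lambda>s. C s \<omega>) t"
    using Z W by (auto simp: has_local_martingale_integral_def)
  obtain C' D' where C': "has_covariation P F M' W C'" and D': "has_covariation P F Z' W D'"
    and ae': "AE \<omega> in P. \<forall>t\<ge>0. D' t \<omega> = stieltjes_integral (\<lambda>s. V s \<omega>) (\<lambda>s. C' s \<omega>) t"
    using Z' W by (auto simp: has_local_martingale_integral_def)
  have CC: "AE \<omega> in P. \<forall>t\<ge>0. C t \<omega> = C' t \<omega>" by (rule covariation_unique[OF C C' M W eq])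
  have DD: "AE \<omega> in P. \<forall>t\<ge>0. D t \<omega> - D' t \<omega> = 0"
    using CC ae ae'
  proof eventually_elim
    case (elim \<omega>)
    have "stieltjes_integral (\<lambda>s. V s \<omega>) (\<lambda>s. C s \<omega>) t = stieltjes_integral (\<lambda>s. V s \<omega>) (\<lambda>s. C' s \<omega>) t" for t
      using elim(1) by (intro stieltjes_integral_cong) auto
    then show ?case using elim by simp
  qed
  have bv: "cont_bv_process P F D" "cont_bv_process P F D'"
    and lm: "cont_local_martingale P F (\<lambda>t \<omega>. Z t \<omega> * W t \<omega> - D t \<omega>)"
      "cont_local_martingale P F (\<lambda>t \<omega>. Z' t \<omega> * W t \<omega> - D' t \<omega>)"
    using D D' by (auto simp: has_covariation_def)
  have null: "cont_local_martingale P F (\<lambda>t \<omega>. D t \<omega> - D' t \<omega>)"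
    using cont_bv_process_lincomb[OF bv, of 1 "- 1"] DD
    by (intro cont_local_martingale_null) (auto simp: cont_bv_process_def)
  have "(\<lambda>t \<omega>. (W t \<omega>)\<^sup>2)
    = (\<lambda>t \<omega>. 1 * ((Z t \<omega> * W t \<omega> - D t \<omega>) - (Z' t \<omega> * W t \<omega> - D' t \<omega>)) + 1 * (D t \<omega> - D' t \<omega>))"
    by (simp add: fun_eq_iff W_def power2_eq_square algebra_simps)
  then have "cont_local_martingale P F (\<lambda>t \<omega>. (W t \<omega>)\<^sup>2)"
    using cont_local_martingale_lincomb[OF cont_local_martingale_diff[OF lm] null, of 1 1] by simp
  then have "AE \<omega> in P. W t \<omega> = 0"
    by (rule cont_local_martingale_square_null[OF _ _ t])
      (use Z Z' in \<open>simp add: W_def has_local_martingale_integral_def\<close>)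
  then show ?thesis by eventually_elim (simp add: W_def)
qed

section \<open>Integrals in the completed filtration\<close>

text \<open>Stochastic integrals are built in the completed filtration; this transfers to it
  everything proved above for an arbitrary filtration.\<close>

lemma filtered_prob_space_completed: "filtered_prob_space P (completed_filtration P F)"
proof -
  have sub: "sets (F t) \<union> null_sets P \<subseteq> Pow (space P)" for t
    using sets.sets_into_space[of _ "F t"] sets.sets_into_space[of _ P] by (auto simp: space_F null_sets_def)
  have sets: "sets (completed_filtration P F t) = sigma_sets (space P) (sets (F t) \<union> null_sets P)" for t
    unfolding completed_filtration_def by (rule sets_measure_of[OF sub])
  show ?thesis
  proof (intro filtered_prob_space.intro filtration.intro filtered_prob_space_axioms.intro)
    show "prob_space P" by unfold_locales
    show "space (completed_filtration P F t) = space P" for t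
      unfolding completed_filtration_def by (rule space_measure_of[OF sub])
    show "sets (completed_filtration P F s) \<subseteq> sets (completed_filtration P F t)" if "s \<le> t" for s t
      unfolding sets by (rule sigma_sets_mono') (use sets_F_mono[OF that] in auto)
    show "sets (completed_filtration P F t) \<subseteq> sets P" for t
      unfolding sets by (rule sets.sigma_sets_subset) (use sets_F_subset in \<open>auto simp: null_sets_def\<close>)
  qed
qed

text \<open>The decomposition is kept, so the constant integrates to \<alpha> times the increments
  of \<open>M\<close> and of \<open>A\<close>, which add up to those of \<open>X\<close>.\<close>

lemma has_stoch_integral_affine:
  assumes Y: "has_stoch_integral P F V X Y" and K: "\<And>s \<omega>. \<bar>V s \<omega>\<bar> \<le> K"
  shows "has_stoch_integral P F (\<lambda>s \<omega>. \<alpha> + \<beta> * V s \<omega>) X (\<lambda>t \<omega>. \<alpha> * (X t \<omega> - X 0 \<omega>) + \<beta> * Y t \<omega>)"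
proof -
  let ?G = "completed_filtration P F"
  interpret G: filtered_prob_space P ?G by (rule filtered_prob_space_completed)
  obtain M A Z where X: "semimartingale_decomp P ?G X M A"
    and Z: "has_local_martingale_integral P ?G V M Z"
    and Y: "AE \<omega> in P. \<forall>t\<ge>0. Y t \<omega> = Z t \<omega> + stieltjes_integral (\<lambda>s. V s \<omega>) (\<lambda>s. A s \<omega>) t"
    using Y unfolding has_stoch_integral_def Let_def by blast
  have M: "cont_local_martingale P ?G M" and A: "cont_bv_process P ?G A"
    using X by (auto simp: semimartingale_decomp_def)
  have path: "bounded_path (\<lambda>s. V s \<omega>)" if "\<omega> \<in> space P" for \<omega>
    using Z by (intro G.progressive_bounded_path[OF _ K that]) (simp add: has_local_martingale_integral_def)
  have "AE \<omega> in P. stieltjes_integrable (\<lambda>s. \<alpha> + \<beta> * V s \<omega>) (\<lambda>s. A s \<omega>)"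
    by (intro AE_I2 bounded_path_stieltjes_integrable bounded_path_affine path G.cont_bv_processD[OF A])
  moreover have "AE \<omega> in P. \<forall>t\<ge>0. \<alpha> * (X t \<omega> - X 0 \<omega>) + \<beta> * Y t \<omega>
    = \<alpha> * (M t \<omega> - M 0 \<omega>) + \<beta> * Z t \<omega> + stieltjes_integral (\<lambda>s. \<alpha> + \<beta> * V s \<omega>) (\<lambda>s. A s \<omega>) t"
    using Y AE_space
  proof eventually_elim
    case (elim \<omega>)
    have "X t \<omega> = M t \<omega> + A t \<omega>" if "0 \<le> t" for t
      using X elim(2) that unfolding semimartingale_decomp_def by blast
    then show ?case
      using elim(1) stieltjes_integral_affine[OF G.cont_bv_processD(1,2)[OF A elim(2)] path[OF elim(2)]]
      by (simp add: algebra_simps)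
  qed
  ultimately show ?thesis
    unfolding has_stoch_integral_def Let_def
    using X G.has_local_martingale_integral_affine[OF Z M K] by blast
qed

text \<open>The two versions may use different decompositions; these agree almost surely, which
  settles the martingale parts by uniqueness and the Stieltjes parts pathwise.\<close>

lemma stoch_integral_unique:
  assumes Y: "has_stoch_integral P F V X Y" "has_stoch_integral P F V X Y'" and t: "0 \<le> t"
  shows "AE \<omega> in P. Y t \<omega> = Y' t \<omega>"
proof -
  let ?G = "completed_filtration P F"
  interpret G: filtered_prob_space P ?G by (rule filtered_prob_space_completed)
  obtain M A Z where X: "semimartingale_decomp P ?G X M A"
    and Z: "has_local_martingale_integral P ?G V M Z"
    and Y1: "AE \<omega> in P. \<forall>t\<ge>0. Y t \<omega> = Z t \<omega> + stieltjes_integral (\<lambda>s. V s \<omega>) (\<lambda>s. A s \<omega>) t"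
    using Y(1) unfolding has_stoch_integral_def Let_def by blast
  obtain M' A' Z' where X': "semimartingale_decomp P ?G X M' A'"
    and Z': "has_local_martingale_integral P ?G V M' Z'"
    and Y2: "AE \<omega> in P. \<forall>t\<ge>0. Y' t \<omega> = Z' t \<omega> + stieltjes_integral (\<lambda>s. V s \<omega>) (\<lambda>s. A' s \<omega>) t"
    using Y(2) unfolding has_stoch_integral_def Let_def by blast
  have MA: "AE \<omega> in P. \<forall>t\<ge>0. M t \<omega> = M' t \<omega> \<and> A t \<omega> = A' t \<omega>"
    by (rule G.semimartingale_decomp_unique[OF X X'])
  have "AE \<omega> in P. Z t \<omega> = Z' t \<omega>"
  proof (rule G.local_martingale_integral_unique[OF Z Z' _ _ _ t])
    show "AE \<omega> in P. \<forall>t\<ge>0. M t \<omega> = M' t \<omega>" using MA by eventually_elim auto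
  qed (use X X' in \<open>auto simp: semimartingale_decomp_def\<close>)
  then show ?thesis using MA Y1 Y2
  proof eventually_elim
    case (elim \<omega>)
    have "stieltjes_integral (\<lambda>s. V s \<omega>) (\<lambda>s. A s \<omega>) t = stieltjes_integral (\<lambda>s. V s \<omega>) (\<lambda>s. A' s \<omega>) t"
      using elim(2) by (intro stieltjes_integral_cong) auto
    then show ?case using elim t by simp
  qed
qed

text \<open>The right-hand side is an explicit version of the integral of the affine image. Hence
  the choice operator on the left also returns a version, and uniqueness identifies the two.\<close>

lemma stoch_integral_affine:
  assumes V: "stoch_integrable P F V X" and K: "\<And>s \<omega>. \<bar>V s \<omega>\<bar> \<le> K" and t: "0 \<le> t"
  shows "AE \<omega> in P. stoch_integral P F (\<lambda>s \<omega>. \<alpha> + \<beta> * V s \<omega>) X t \<omega>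
    = \<alpha> * (X t \<omega> - X 0 \<omega>) + \<beta> * stoch_integral P F V X t \<omega>"
proof (rule stoch_integral_unique[OF _ _ t])
  have "has_stoch_integral P F V X (stoch_integral P F V X)"
    using V unfolding stoch_integrable_def stoch_integral_def by (rule someI_ex)
  then show *: "has_stoch_integral P F (\<lambda>s \<omega>. \<alpha> + \<beta> * V s \<omega>) X
      (\<lambda>t \<omega>. \<alpha> * (X t \<omega> - X 0 \<omega>) + \<beta> * stoch_integral P F V X t \<omega>)"
    by (rule has_stoch_integral_affine[OF _ K])
  show "has_stoch_integral P F (\<lambda>s \<omega>. \<alpha> + \<beta> * V s \<omega>) X (stoch_integral P F (\<lambda>s \<omega>. \<alpha> + \<beta> * V s \<omega>) X)"
    unfolding stoch_integral_def by (rule someI[where P="has_stoch_integral P F (\<lambda>s \<omega>. \<alpha> + \<beta> * V s \<omega>) X", OF *])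
qed

end

section \<open>Tanaka's formulas\<close>

theorem proposition5p3:
  fixes P :: "'a measure" and F :: "real \<Rightarrow> 'a measure"
    and X L :: "real \<Rightarrow> 'a \<Rightarrow> real" and x t :: real
  assumes "filtered_prob_space P F"
    and "cont_semimartingale P F X"
    and "is_local_time P F X x L"
    and "t \<ge> 0"
  shows "AE \<omega> in P.
      \<bar>X t \<omega> - x\<bar> = \<bar>X 0 \<omega> - x\<bar>
        + stoch_integral P F (\<lambda>s \<omega>. lsgn (X s \<omega> - x)) X t \<omega> + L t \<omega> \<and>
      max (X t \<omega> - x) 0 = max (X 0 \<omega> - x) 0
        + stoch_integral P F (\<lambda>s \<omega>. of_bool (X s \<omega> > x)) X t \<omega> + 1/2 * L t \<omega> \<and>
      max (- (X t \<omega> - x)) 0 = max (- (X 0 \<omega> - x)) 0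
        - stoch_integral P F (\<lambda>s \<omega>. of_bool (X s \<omega> \<le> x)) X t \<omega> + 1/2 * L t \<omega>"
proof -
  interpret filtered_prob_space P F by fact
  let ?V = "\<lambda>s \<omega>. lsgn (X s \<omega> - x)"
  have int: "stoch_integrable P F ?V X"
    and L: "AE \<omega> in P. \<forall>t\<ge>0. L t \<omega> = \<bar>X t \<omega> - x\<bar> - \<bar>X 0 \<omega> - x\<bar> - stoch_integral P F ?V X t \<omega>"
    using assms(3) by (auto simp: is_local_time_def)
  have bound: "\<bar>?V s \<omega>\<bar> \<le> 1" for s \<omega> by (simp add: lsgn_def)
  \<comment> \<open>Exact also where \<open>X s \<omega> = x\<close>: the value -1 of
    \<open>lsgn\<close> at 0 matches the strict inequality here and the weak one below.\<close>
  have pos: "(\<lambda>s \<omega>. of_bool (X s \<omega> > x)) = (\<lambda>s \<omega>. 1 / 2 + 1 / 2 * ?V s \<omega>)"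
    and neg: "(\<lambda>s \<omega>. of_bool (X s \<omega> \<le> x)) = (\<lambda>s \<omega>. 1 / 2 + (- 1 / 2) * ?V s \<omega>)"
    by (auto simp: fun_eq_iff lsgn_def)
  have "AE \<omega> in P. stoch_integral P F (\<lambda>s \<omega>. of_bool (X s \<omega> > x)) X t \<omega>
      = 1 / 2 * (X t \<omega> - X 0 \<omega>) + 1 / 2 * stoch_integral P F ?V X t \<omega>"
    unfolding pos by (rule stoch_integral_affine[OF int bound assms(4)])
  moreover have "AE \<omega> in P. stoch_integral P F (\<lambda>s \<omega>. of_bool (X s \<omega> \<le> x)) X t \<omega>
      = 1 / 2 * (X t \<omega> - X 0 \<omega>) + (- 1 / 2) * stoch_integral P F ?V X t \<omega>"
    unfolding neg by (rule stoch_integral_affine[OF int bound assms(4)])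
  ultimately show ?thesis using L
  proof eventually_elim
    case (elim \<omega>)
    have "L t \<omega> = \<bar>X t \<omega> - x\<bar> - \<bar>X 0 \<omega> - x\<bar> - stoch_integral P F ?V X t \<omega>"
      using elim(3) assms(4) by blast
    \<comment> \<open>Here \<open>max v 0\<close> is \<open>(\<bar>v\<bar> + v) / 2\<close> and
      \<open>max (- v) 0\<close> is \<open>(\<bar>v\<bar> - v) / 2\<close>, for \<open>v\<close>
      equal to \<open>X t \<omega> - x\<close> and to \<open>X 0 \<omega> - x\<close>.\<close>
    then show ?case unfolding elim(1,2) by (auto simp: max_def abs_if field_simps)
  qed
qed

end
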